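(* Let $(X_t)_{t\ge 0}$, $(\mathbb{P}_x)_{x\in E}$ be an irreducible Markov jump process on the finite set $E$ with invariant distribution $\pi$ and generator $L$, let $f:E\to\mathbb{R}$ be non-constant with $\pi(f)=0$, let $\nu$ be a probability measure on $E$, and let $A_t=\int_0^t f(X_s)\,ds$ for $t>0$. Let $\tilde\sigma_f^2:=2\,\mathrm{Var}_\pi(f)/\lambda_1$. Then for all $u\ge0$ $$\mathbb{P}_\nu\left(\frac{A_t}{t}\ge u\right)\le\left\|\frac{d\nu}{d\pi}\right\|_2\exp\left(-\frac{2tu^2}{\tilde\sigma_f^2\left(1+\sqrt{1+\frac{2\|f\|_\infty u}{\lambda_1\tilde\sigma_f^2}}\right)^2}\right).$$
   Context: $E$ is a finite set with at least two elements. A Markov jump process (MJP) on $E$ is an $E$-valued process $(X_t)_{t\ge0}$ with right-continuous (piecewise constant) paths together with probability measures $(\mathbb{P}_x)_{x\in E}$ such that $\mathbb{P}_x(X_0=x)=1$ and the (time-homogeneous) Markov property holds. Its transition function is $p_{xy}(t)=\mathbb{P}_x(X_t=y)=(\exp(tQ))_{xy}$ for a unique matrix $Q=(q_{xy})$ with $q_{xy}\ge0$ for $x\ne y$ and $\sum_y q_{xy}=0$. It is irreducible if $p_{xy}(t)>0$ for all $x,y\in E$, $t>0$; then it has a unique invariant distribution $\pi$ ($\pi^TQ=0$), and $\pi_x>0$ for all $x$. Write $\mathbb{P}_\nu=\sum_x\nu_x\mathbb{P}_x$ for a probability measure $\nu$ on $E$, $\mu(g)=\int g\,d\mu$, and $\mathrm{Var}_\pi(g)=\pi(g^2)-\pi(g)^2$.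 $L^2(\pi)$ is the real space of all functions $E\to\mathbb{R}$ with inner product $\langle g,h\rangle=\sum_x g(x)h(x)\pi_x$ and norm $\|\cdot\|_2$; $\|f\|_\infty=\max_x|f(x)|$. The infinitesimal generator $L$ is the operator on $L^2(\pi)$ given by $(Lg)(x)=\sum_y q_{xy}g(y)$, and $L^*$ is its adjoint in $L^2(\pi)$. $\frac{d\nu}{d\pi}(x)=\nu_x/\pi_x$. The spectral gap is $\lambda_1:=\min\{|\lambda|:\lambda\in\sigma(\frac{L+L^*}{2})\setminus\{0\}\}>0$. *)

theory Defs
  imports "HOL-Probability.Probability"
begin

section \<open>Markov jump processes on a finite state space\<close>

text \<open>
  A finite state space is a type of class \<open>finite\<close>, a probability measure on it is a \<open>pmf\<close>.
  The measurable space \<open>M\<close> underlies all the laws \<open>P x\<close>; any measure that \<open>M\<close> itself carries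
  is irrelevant. Only the times \<open>t \<ge> 0\<close> of \<open>X t\<close> matter.
\<close>

definition transition ::
  "('e \<Rightarrow> 'w measure) \<Rightarrow> (real \<Rightarrow> 'w \<Rightarrow> 'e) \<Rightarrow> real \<Rightarrow> 'e \<Rightarrow> 'e \<Rightarrow> real" where
  "transition P X t x y = measure (P x) {\<omega> \<in> space (P x). X t \<omega> = y}"

definition past :: "'w measure \<Rightarrow> (real \<Rightarrow> 'w \<Rightarrow> 'e) \<Rightarrow> real \<Rightarrow> 'w measure" where
  "past M X s = sigma (space M) {X r -` {y} \<inter> space M | r y. 0 \<le> r \<and> r \<le> s}"

text \<open>
  The state space carries the discrete topology, so right-continuity of a path at \<open>t\<close> says
  that the path is constant on some interval \<open>[t, t + \<epsilon>)\<close>.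
\<close>

locale markov_jump_process =
  fixes M :: "'w measure"
    and P :: "'e::finite \<Rightarrow> 'w measure"
    and X :: "real \<Rightarrow> 'w \<Rightarrow> 'e"
  assumes prob: "prob_space (P x)"
    and sets_P: "sets (P x) = sets M"
    and measurable_X: "0 \<le> t \<Longrightarrow> X t \<in> measurable M (count_space UNIV)"
    and right_continuous:
      "\<omega> \<in> space M \<Longrightarrow> 0 \<le> t \<Longrightarrow> \<forall>\<^sub>F s in at_right t. X s \<omega> = X t \<omega>"
    and start: "measure (P x) {\<omega> \<in> space M. X 0 \<omega> = x} = 1"
    and markov: "0 \<le> s \<Longrightarrow> 0 \<le> t \<Longrightarrow>
      AE \<omega> in P x. real_cond_exp (P x) (past M X s) (indicator {\<omega>' \<in> space M. X (s + t) \<omega>' = z}) \<omega>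
        = transition P X t (X s \<omega>) z"

text \<open>
  Multiplication of \<open>real ^ 'n ^ 'n\<close> in the type class sense is componentwise, so the library's
  \<open>exp\<close> is not the matrix exponential.
\<close>

definition mat_exp :: "real ^ 'n ^ 'n \<Rightarrow> real ^ 'n ^ 'n" where
  "mat_exp A = (\<Sum>k. (1 / fact k) *\<^sub>R (((**) A ^^ k) (mat 1)))"

definition rate_matrix ::
  "('e::finite \<Rightarrow> 'w measure) \<Rightarrow> (real \<Rightarrow> 'w \<Rightarrow> 'e) \<Rightarrow> real ^ 'e ^ 'e \<Rightarrow> bool" where
  "rate_matrix P X Q \<longleftrightarrow>
     (\<forall>x y. x \<noteq> y \<longrightarrow> 0 \<le> Q $ x $ y) \<and>
     (\<forall>x. (\<Sum>y\<in>UNIV. Q $ x $ y) = 0) \<and>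
     (\<forall>t\<ge>0. \<forall>x y. transition P X t x y = mat_exp (t *\<^sub>R Q) $ x $ y)"

definition irreducible_mjp :: "('e \<Rightarrow> 'w measure) \<Rightarrow> (real \<Rightarrow> 'w \<Rightarrow> 'e) \<Rightarrow> bool" where
  "irreducible_mjp P X \<longleftrightarrow> (\<forall>x y. \<forall>t>0. 0 < transition P X t x y)"

definition invariant_distribution :: "real ^ 'e ^ 'e \<Rightarrow> 'e::finite pmf \<Rightarrow> bool" where
  "invariant_distribution Q \<pi> \<longleftrightarrow> (\<forall>y. (\<Sum>x\<in>UNIV. pmf \<pi> x * Q $ x $ y) = 0)"

definition initial_prob ::
  "('e::finite \<Rightarrow> 'w measure) \<Rightarrow> 'e pmf \<Rightarrow> 'w set \<Rightarrow> real" where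
  "initial_prob P \<nu> A = (\<Sum>x\<in>UNIV. pmf \<nu> x * measure (P x) A)"

definition additive_functional ::
  "(real \<Rightarrow> 'w \<Rightarrow> 'e) \<Rightarrow> ('e \<Rightarrow> real) \<Rightarrow> real \<Rightarrow> 'w \<Rightarrow> real" where
  "additive_functional X f t \<omega> = set_lebesgue_integral lborel {0..t} (\<lambda>s. f (X s \<omega>))"

section \<open>The space \<open>L\<^sup>2(\<pi>)\<close>, the generator and its spectral gap\<close>

definition l2_inner :: "'e::finite pmf \<Rightarrow> ('e \<Rightarrow> real) \<Rightarrow> ('e \<Rightarrow> real) \<Rightarrow> real" where
  "l2_inner \<pi> g h = (\<Sum>x\<in>UNIV. g x * h x * pmf \<pi> x)"

definition l2_norm :: "'e::finite pmf \<Rightarrow> ('e \<Rightarrow> real) \<Rightarrow> real" where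
  "l2_norm \<pi> g = sqrt (l2_inner \<pi> g g)"

definition sup_norm :: "('e::finite \<Rightarrow> real) \<Rightarrow> real" where
  "sup_norm f = Max (range (\<lambda>x. \<bar>f x\<bar>))"

text \<open>The description determines the adjoint uniquely as soon as \<open>pmf \<pi> x > 0\<close> for all \<open>x\<close>.\<close>

definition l2_adjoint ::
  "'e::finite pmf \<Rightarrow> (('e \<Rightarrow> real) \<Rightarrow> 'e \<Rightarrow> real) \<Rightarrow> ('e \<Rightarrow> real) \<Rightarrow> 'e \<Rightarrow> real" where
  "l2_adjoint \<pi> T = (THE T'. \<forall>g h. l2_inner \<pi> (T g) h = l2_inner \<pi> g (T' h))"

definition generator :: "real ^ 'e ^ 'e \<Rightarrow> ('e::finite \<Rightarrow> real) \<Rightarrow> 'e \<Rightarrow> real" where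
  "generator Q g x = (\<Sum>y\<in>UNIV. Q $ x $ y * g y)"

definition sym_generator ::
  "'e::finite pmf \<Rightarrow> real ^ 'e ^ 'e \<Rightarrow> ('e \<Rightarrow> real) \<Rightarrow> 'e \<Rightarrow> real" where
  "sym_generator \<pi> Q g x = (generator Q g x + l2_adjoint \<pi> (generator Q) g x) / 2"

text \<open>
  The spectrum as an operator on a real space; it is applied only to self-adjoint operators,
  whose complex spectrum is real.
\<close>

definition op_spectrum :: "(('e \<Rightarrow> real) \<Rightarrow> 'e \<Rightarrow> real) \<Rightarrow> real set" where
  "op_spectrum T = {l. \<not> bij (\<lambda>g x. T g x - l * g x)}"

definition spectral_gap :: "'e::finite pmf \<Rightarrow> real ^ 'e ^ 'e \<Rightarrow> real" where
  "spectral_gap \<pi> Q = Min {\<bar>l\<bar> | l. l \<in> op_spectrum (sym_generator \<pi> Q) - {0}}"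

definition variance_proxy :: "'e::finite pmf \<Rightarrow> real ^ 'e ^ 'e \<Rightarrow> ('e \<Rightarrow> real) \<Rightarrow> real" where
  "variance_proxy \<pi> Q f = 2 * measure_pmf.variance \<pi> f / spectral_gap \<pi> Q"

end

theory Submission
  imports Defs
begin

text \<open>
  By Chernoff's inequality, the probability is at most \<open>exp (- r t u)\<close> times the exponential moment of
  \<open>r A\<^sub>t\<close> under \<open>\<nu>\<close>, for every \<open>r \<ge> 0\<close>. The Feynman-Kac formula writes this moment as
  \<open>\<langle>d\<nu>/d\<pi>, exp (t (L + r f)) 1\<rangle>\<close>, so it is at most \<open>\<parallel>d\<nu>/d\<pi>\<parallel>\<^sub>2 exp (t \<Lambda>(r))\<close>, where \<open>\<Lambda>(r)\<close> is the supremum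
  of \<open>\<langle>g, (L + r f) g\<rangle>\<close> over unit vectors \<open>g\<close>.

  To bound \<open>\<Lambda>(r)\<close>, split \<open>g\<close> into a constant and a part orthogonal to the constants. On the second part
  \<open>\<langle>g, L g\<rangle> \<le> - \<lambda>\<^sub>1 \<parallel>g\<parallel>\<^sup>2\<close> (\<open>Poincare\<close>). Since \<open>f\<close> has mean zero, completing the
  square gives \<open>\<Lambda>(r) \<le> r\<^sup>2 Var(f) / (\<lambda>\<^sub>1 - r \<parallel>f\<parallel>\<^sub>\<infinity>)\<close> whenever \<open>r \<parallel>f\<parallel>\<^sub>\<infinity> < \<lambda>\<^sub>1\<close> (\<open>perturbed_form_bound\<close>).
  Optimising over \<open>r\<close> yields the exponent of the theorem (\<open>Bernstein_optimal_tilt\<close>).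

  The Feynman-Kac formula is used in discrete time only. The integral \<open>A\<^sub>t\<close> is the limit of Riemann sums
  with \<open>n\<close> nodes (\<open>Riemann_sums_LIMSEQ\<close>), whose exponential moments are, by the Markov property, given by the
  \<open>n\<close>-th power of the kernel \<open>exp (h Q)\<close> followed by multiplication with \<open>exp (h r f)\<close>, where \<open>h = t / n\<close>
  (\<open>exponential_moment_Riemann_sum\<close>). This kernel is \<open>1 + h (L + r f) + o(h)\<close>, so its norm is at most
  \<open>exp (h (\<Lambda>(r) + \<epsilon>))\<close> for small \<open>h\<close>, and its \<open>n\<close>-th power has norm at most
  \<open>exp (t (\<Lambda>(r) + \<epsilon>))\<close> (\<open>n_step_growth\<close>). Letting \<open>n \<rightarrow> \<infinity>\<close> and then \<open>\<epsilon> \<rightarrow> 0\<close> gives the bound.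
\<close>

section \<open>Bilinear algebra in \<open>L\<^sup>2(\<pi>)\<close>\<close>

lemma l2_inner_commute: "l2_inner \<pi> g h = l2_inner \<pi> h g"
  by (simp add: l2_inner_def mult.commute)

lemma l2_inner_add_left: "l2_inner \<pi> (\<lambda>x. a x + b x) h = l2_inner \<pi> a h + l2_inner \<pi> b h"
  by (simp add: l2_inner_def algebra_simps sum.distrib)

lemma l2_inner_add_right: "l2_inner \<pi> h (\<lambda>x. a x + b x) = l2_inner \<pi> h a + l2_inner \<pi> h b"
  by (simp add: l2_inner_def algebra_simps sum.distrib)

lemma l2_inner_scale_left: "l2_inner \<pi> (\<lambda>x. c * a x) h = c * l2_inner \<pi> a h"
  by (simp add: l2_inner_def algebra_simps sum_distrib_left)

lemma l2_inner_scale_right: "l2_inner \<pi> h (\<lambda>x. c * a x) = c * l2_inner \<pi> h a"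
  by (simp add: l2_inner_def algebra_simps sum_distrib_left)

lemma l2_inner_self_nonneg: "0 \<le> l2_inner \<pi> g g"
  by (auto simp: l2_inner_def intro!: sum_nonneg)

lemma l2_inner_self_eq_0:
  assumes "\<And>x. 0 < pmf \<pi> x" "l2_inner \<pi> g g = 0"
  shows "g x = 0"
proof -
  have "\<forall>x\<in>UNIV. g x * g x * pmf \<pi> x = 0"
    using assms(2) unfolding l2_inner_def by (subst (asm) sum_nonneg_eq_0_iff) auto
  then show ?thesis using assms(1)[of x] by (auto dest!: spec[of _ x])
qed

lemma l2_norm_nonneg: "0 \<le> l2_norm \<pi> g"
  by (simp add: l2_norm_def l2_inner_self_nonneg)

lemma l2_norm_power2: "(l2_norm \<pi> g)\<^sup>2 = l2_inner \<pi> g g"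
  by (simp add: l2_norm_def l2_inner_self_nonneg)

lemma l2_Cauchy_Schwarz: "\<bar>l2_inner \<pi> g h\<bar> \<le> l2_norm \<pi> g * l2_norm \<pi> h"
proof (rule abs_le_square_iff[THEN iffD2, THEN order_trans, of _ "l2_norm \<pi> g * l2_norm \<pi> h"])
  let ?s = "\<lambda>x. sqrt (pmf \<pi> x)"
  have "(\<Sum>x\<in>UNIV. (g x * ?s x) * (h x * ?s x))\<^sup>2
      \<le> (\<Sum>x\<in>UNIV. (g x * ?s x)\<^sup>2) * (\<Sum>x\<in>UNIV. (h x * ?s x)\<^sup>2)"
    by (rule Cauchy_Schwarz_ineq_sum)
  also have "(\<Sum>x\<in>UNIV. (g x * ?s x) * (h x * ?s x)) = l2_inner \<pi> g h"
    unfolding l2_inner_def by (intro sum.cong refl) (simp add: algebra_simps flip: power2_eq_square)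
  also have "(\<Sum>x\<in>UNIV. (g x * ?s x)\<^sup>2) = l2_inner \<pi> g g"
    unfolding l2_inner_def by (intro sum.cong refl) (simp add: power_mult_distrib power2_eq_square)
  also have "(\<Sum>x\<in>UNIV. (h x * ?s x)\<^sup>2) = l2_inner \<pi> h h"
    unfolding l2_inner_def by (intro sum.cong refl) (simp add: power_mult_distrib power2_eq_square)
  finally show "(l2_inner \<pi> g h)\<^sup>2 \<le> (l2_norm \<pi> g * l2_norm \<pi> h)\<^sup>2"
    by (simp add: power_mult_distrib l2_norm_power2)
qed (simp add: l2_norm_nonneg)

lemma l2_inner_one: "l2_inner \<pi> (\<lambda>_. 1) (\<lambda>_. 1) = 1"
  by (simp add: l2_inner_def sum_pmf_eq_1)

lemma abs_le_sup_norm: "\<bar>f x\<bar> \<le> sup_norm f"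
  by (simp add: sup_norm_def)

section \<open>The matrix exponential\<close>

lemma mat_pow_entry_bound:
  fixes A :: "real ^ 'n::finite ^ 'n"
  shows "\<bar>(((**) A ^^ k) (mat 1)) $ x $ y\<bar> \<le> (\<Sum>x\<in>UNIV. \<Sum>y\<in>UNIV. \<bar>A $ x $ y\<bar>) ^ k"
proof (induction k arbitrary: x)
  case 0
  then show ?case by (simp add: mat_def)
next
  case (Suc k)
  let ?C = "\<Sum>x\<in>UNIV. \<Sum>y\<in>UNIV. \<bar>A $ x $ y\<bar>"
  let ?B = "((**) A ^^ k) (mat 1)"
  have C: "(\<Sum>z\<in>UNIV. \<bar>A $ x $ z\<bar>) \<le> ?C"
    by (rule member_le_sum[of x UNIV "\<lambda>x. \<Sum>y\<in>UNIV. \<bar>A $ x $ y\<bar>"]) (auto intro: sum_nonneg)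
  have "\<bar>(A ** ?B) $ x $ y\<bar> \<le> (\<Sum>z\<in>UNIV. \<bar>A $ x $ z\<bar> * \<bar>?B $ z $ y\<bar>)"
    unfolding matrix_matrix_mult_def by (simp add: sum_abs flip: abs_mult)
  also have "\<dots> \<le> (\<Sum>z\<in>UNIV. \<bar>A $ x $ z\<bar> * ?C ^ k)"
    by (intro sum_mono mult_left_mono Suc.IH) auto
  also have "\<dots> = (\<Sum>z\<in>UNIV. \<bar>A $ x $ z\<bar>) * ?C ^ k"
    by (simp add: sum_distrib_right)
  also have "\<dots> \<le> ?C * ?C ^ k"
    by (intro mult_right_mono C zero_le_power sum_nonneg) auto
  finally show ?case by simp
qed

lemma mat_pow_scaleR:
  fixes A :: "real ^ 'n::finite ^ 'n"
  shows "((**) (t *\<^sub>R A) ^^ k) (mat 1) = t ^ k *\<^sub>R ((**) A ^^ k) (mat 1)"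
  by (induction k) (auto simp: vec_eq_iff matrix_matrix_mult_def sum_distrib_left algebra_simps)

lemma mat_exp_entry_summable:
  fixes A :: "real ^ 'n::finite ^ 'n"
  shows "summable (\<lambda>k. (((**) A ^^ k) (mat 1)) $ x $ y / fact k * t ^ k)"
proof (rule summable_comparison_test'[OF summable_exp])
  fix k :: nat
  let ?C = "\<Sum>x\<in>UNIV. \<Sum>y\<in>UNIV. \<bar>A $ x $ y\<bar>"
  have "\<bar>((**) A ^^ k) (mat 1) $ x $ y\<bar> * \<bar>t\<bar> ^ k \<le> ?C ^ k * \<bar>t\<bar> ^ k"
    by (intro mult_right_mono mat_pow_entry_bound) auto
  then show "norm (((**) A ^^ k) (mat 1) $ x $ y / fact k * t ^ k) \<le> inverse (fact k) * (?C * \<bar>t\<bar>) ^ k"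
    by (simp add: abs_mult power_abs power_mult_distrib divide_simps)
qed

text \<open>
  Entry by entry, \<open>t \<mapsto> exp (t A)\<close> is an everywhere convergent power series in \<open>t\<close>, since the
  entries of \<open>A\<close>'s powers grow at most geometrically. This reduces the facts below to
  scalar power series; for instance, the derivative at \<open>0\<close> is the coefficient of \<open>t\<close>.
\<close>

lemma mat_exp_entry_sums:
  fixes A :: "real ^ 'n::finite ^ 'n"
  shows "(\<lambda>k. (((**) A ^^ k) (mat 1)) $ x $ y / fact k * t ^ k) sums (mat_exp (t *\<^sub>R A) $ x $ y)"
proof -
  define S where "S = (\<chi> x y. \<Sum>k. (((**) A ^^ k) (mat 1)) $ x $ y / fact k * t ^ k)"
  have *: "(\<lambda>k. (((**) A ^^ k) (mat 1)) $ x $ y / fact k * t ^ k) sums (S $ x $ y)" for x y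
    unfolding S_def using summable_sums[OF mat_exp_entry_summable[of A x y t]] by simp
  have "(\<lambda>k. (1 / fact k) *\<^sub>R (((**) (t *\<^sub>R A) ^^ k) (mat 1))) sums S"
    unfolding sums_def
  proof (intro vec_tendstoI)
    fix x y
    show "(\<lambda>n. (\<Sum>k<n. (1 / fact k) *\<^sub>R ((**) (t *\<^sub>R A) ^^ k) (mat 1)) $ x $ y) \<longlonglongrightarrow> S $ x $ y"
      using *[of x y] unfolding sums_def mat_pow_scaleR by (simp add: field_simps)
  qed
  then have "mat_exp (t *\<^sub>R A) = S" unfolding mat_exp_def by (simp add: sums_iff)
  with * show ?thesis by simp
qed

lemma mat_exp_entry_deriv_0:
  fixes A :: "real ^ 'n::finite ^ 'n"
  shows "((\<lambda>t. mat_exp (t *\<^sub>R A) $ x $ y) has_field_derivative A $ x $ y) (at 0)"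
proof -
  let ?c = "\<lambda>k. (((**) A ^^ k) (mat 1)) $ x $ y / fact k"
  have "((\<lambda>t. \<Sum>k. ?c k * t ^ k) has_field_derivative (\<Sum>k. diffs ?c k * 0 ^ k)) (at 0)"
    by (rule termdiffs_strong_converges_everywhere) (rule mat_exp_entry_summable)
  moreover have "(\<Sum>k. ?c k * t ^ k) = mat_exp (t *\<^sub>R A) $ x $ y" for t
    by (rule sums_unique[symmetric]) (rule mat_exp_entry_sums)
  moreover have "(\<Sum>k. diffs ?c k * 0 ^ k) = A $ x $ y"
    unfolding powser_zero by (simp add: diffs_def)
  ultimately show ?thesis by simp
qed

lemma mat_exp_0: "mat_exp (0 *\<^sub>R A) $ x $ y = (if x = y then 1 else 0)"
  using sums_unique[OF mat_exp_entry_sums[of A x y 0]]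
  unfolding powser_zero by (simp add: mat_def)

text \<open>
  If \<open>A h = 0\<close> then all terms of \<open>exp (t A) h\<close> but the first vanish; dually for \<open>\<pi> A = 0\<close>.
  Applied to a rate matrix, these transfer positivity of the transition function to two
  facts about \<open>Q\<close>: its kernel consists of constants, and \<open>\<pi>\<close> charges every state.
\<close>

lemma mat_exp_fixes_kernel:
  fixes A :: "real ^ 'n::finite ^ 'n"
  assumes "generator A h = (\<lambda>_. 0)"
  shows "(\<Sum>y\<in>UNIV. mat_exp (t *\<^sub>R A) $ x $ y * h y) = h x"
proof -
  let ?B = "\<lambda>k. ((**) A ^^ k) (mat 1)"
  have step: "(\<Sum>y\<in>UNIV. ?B (Suc k) $ x $ y * h y) = (\<Sum>z\<in>UNIV. A $ x $ z * (\<Sum>y\<in>UNIV. ?B k $ z $ y * h y))" for k x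
    unfolding funpow.simps o_def matrix_matrix_mult_def
    by (simp add: sum_distrib_left sum_distrib_right mult.assoc) (rule sum.swap)
  have z: "(\<Sum>y\<in>UNIV. ?B (Suc k) $ x $ y * h y) = 0" for k x
  proof (induction k arbitrary: x)
    case 0
    have "(\<Sum>y\<in>UNIV. ?B 0 $ z $ y * h y) = h z" for z by (simp add: mat_def if_distrib if_distribR cong: if_cong)
    then show ?case unfolding step using fun_cong[OF assms, of x] by (simp add: generator_def)
  next
    case (Suc k)
    then show ?case by (subst step) (simp del: funpow.simps)
  qed
  have "(\<lambda>k. \<Sum>y\<in>UNIV. ?B k $ x $ y / fact k * t ^ k * h y) sums (\<Sum>y\<in>UNIV. mat_exp (t *\<^sub>R A) $ x $ y * h y)"
    by (intro sums_sum sums_mult2 mat_exp_entry_sums)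
  moreover have "(\<Sum>y\<in>UNIV. ?B k $ x $ y / fact k * t ^ k * h y) = (if k = 0 then h x else 0)" for k
  proof (cases k)
    case 0
    then show ?thesis by (simp add: mat_def if_distrib if_distribR cong: if_cong)
  next
    case (Suc j)
    have "(\<Sum>y\<in>UNIV. ?B k $ x $ y / fact k * t ^ k * h y) = t ^ k / fact k * (\<Sum>y\<in>UNIV. ?B k $ x $ y * h y)"
      by (simp add: sum_distrib_left algebra_simps)
    then show ?thesis using z[of j x] Suc by (simp del: funpow.simps)
  qed
  ultimately have "(\<lambda>k. if k = 0 then h x else 0) sums (\<Sum>y\<in>UNIV. mat_exp (t *\<^sub>R A) $ x $ y * h y)" by simp
  moreover have "(\<lambda>k::nat. if k = 0 then h x else 0) sums h x" by (rule sums_single)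
  ultimately show ?thesis by (rule sums_unique2)
qed

lemma mat_exp_fixes_invariant:
  fixes A :: "real ^ 'n::finite ^ 'n"
  assumes "invariant_distribution A \<pi>"
  shows "(\<Sum>x\<in>UNIV. pmf \<pi> x * mat_exp (t *\<^sub>R A) $ x $ y) = pmf \<pi> y"
proof -
  let ?B = "\<lambda>k. ((**) A ^^ k) (mat 1)"
  have z: "(\<Sum>x\<in>UNIV. pmf \<pi> x * ?B (Suc k) $ x $ y) = 0" for k
  proof -
    have "(\<Sum>x\<in>UNIV. pmf \<pi> x * ?B (Suc k) $ x $ y) = (\<Sum>z\<in>UNIV. (\<Sum>x\<in>UNIV. pmf \<pi> x * A $ x $ z) * ?B k $ z $ y)"
      unfolding funpow.simps o_def matrix_matrix_mult_def
      by (simp add: sum_distrib_left sum_distrib_right mult.assoc) (rule sum.swap)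
    then show ?thesis using assms by (simp add: invariant_distribution_def)
  qed
  have "(\<lambda>k. \<Sum>x\<in>UNIV. pmf \<pi> x * (?B k $ x $ y / fact k * t ^ k)) sums
      (\<Sum>x\<in>UNIV. pmf \<pi> x * mat_exp (t *\<^sub>R A) $ x $ y)"
    by (intro sums_sum sums_mult mat_exp_entry_sums)
  moreover have "(\<Sum>x\<in>UNIV. pmf \<pi> x * (?B k $ x $ y / fact k * t ^ k)) = (if k = 0 then pmf \<pi> y else 0)" for k
  proof (cases k)
    case 0
    then show ?thesis by (simp add: mat_def if_distrib if_distribR cong: if_cong)
  next
    case (Suc j)
    have "(\<Sum>x\<in>UNIV. pmf \<pi> x * (?B k $ x $ y / fact k * t ^ k)) = t ^ k / fact k * (\<Sum>x\<in>UNIV. pmf \<pi> x * ?B k $ x $ y)"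
      by (simp add: sum_distrib_left algebra_simps)
    then show ?thesis using z[of j] Suc by (simp del: funpow.simps)
  qed
  ultimately have "(\<lambda>k. if k = 0 then pmf \<pi> y else 0) sums (\<Sum>x\<in>UNIV. pmf \<pi> x * mat_exp (t *\<^sub>R A) $ x $ y)" by simp
  moreover have "(\<lambda>k::nat. if k = 0 then pmf \<pi> y else 0) sums pmf \<pi> y" by (rule sums_single)
  ultimately show ?thesis by (rule sums_unique2)
qed

section \<open>The adjoint and the spectrum of a matrix acting on functions\<close>

text \<open>
  The matrix of the \<open>L\<^sup>2(\<pi>)\<close>-adjoint of \<open>A\<close>. If \<open>A\<close> generates a stationary jump process with law
  \<open>\<pi>\<close>, these are the rates of the process run backwards in time.
\<close>

definition time_reversal :: "'e::finite pmf \<Rightarrow> real ^ 'e ^ 'e \<Rightarrow> real ^ 'e ^ 'e" where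
  "time_reversal \<pi> A = (\<chi> x y. pmf \<pi> y * A $ y $ x / pmf \<pi> x)"

lemma l2_inner_generator_left:
  assumes "\<And>x. 0 < pmf \<pi> x"
  shows "l2_inner \<pi> (generator A g) h = l2_inner \<pi> g (generator (time_reversal \<pi> A) h)"
proof -
  have "l2_inner \<pi> (generator A g) h = (\<Sum>x\<in>UNIV. \<Sum>y\<in>UNIV. A $ x $ y * g y * h x * pmf \<pi> x)"
    by (simp add: l2_inner_def generator_def sum_distrib_right)
  also have "\<dots> = (\<Sum>y\<in>UNIV. \<Sum>x\<in>UNIV. A $ x $ y * g y * h x * pmf \<pi> x)"
    by (rule sum.swap)
  also have "\<dots> = l2_inner \<pi> g (generator (time_reversal \<pi> A) h)"
    unfolding l2_inner_def generator_def time_reversal_def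
  proof (intro sum.cong refl)
    fix y
    have "pmf \<pi> y \<noteq> 0" using assms[of y] by simp
    then show "(\<Sum>x\<in>UNIV. A $ x $ y * g y * h x * pmf \<pi> x)
        = g y * (\<Sum>x\<in>UNIV. (\<chi> x y. pmf \<pi> y * A $ y $ x / pmf \<pi> x) $ y $ x * h x) * pmf \<pi> y"
      by (simp add: sum_distrib_left sum_distrib_right field_simps)
  qed
  finally show ?thesis .
qed

lemma l2_adjoint_generator:
  assumes "\<And>x. 0 < pmf \<pi> x"
  shows "l2_adjoint \<pi> (generator A) = generator (time_reversal \<pi> A)"
  unfolding l2_adjoint_def
proof (rule the_equality)
  show "\<forall>g h. l2_inner \<pi> (generator A g) h = l2_inner \<pi> g (generator (time_reversal \<pi> A) h)"
    using l2_inner_generator_left[OF assms] by blast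
next
  fix T assume T: "\<forall>g h. l2_inner \<pi> (generator A g) h = l2_inner \<pi> g (T h)"
  show "T = generator (time_reversal \<pi> A)"
  proof (intro ext)
    fix h x
    have ind: "l2_inner \<pi> (indicator {x}) k = k x * pmf \<pi> x" for k
    proof -
      have "l2_inner \<pi> (indicator {x}) k = (\<Sum>y\<in>UNIV. if y = x then k y * pmf \<pi> y else 0)"
        unfolding l2_inner_def by (intro sum.cong) auto
      then show ?thesis by simp
    qed
    have "l2_inner \<pi> (indicator {x}) (T h) = l2_inner \<pi> (indicator {x}) (generator (time_reversal \<pi> A) h)"
      using T l2_inner_generator_left[OF assms, where A=A] by simp
    then show "T h x = generator (time_reversal \<pi> A) h x"
      using assms[of x] by (simp add: ind)
  qed
qed

lemma generator_add: "generator A (\<lambda>x. g x + h x) = (\<lambda>x. generator A g x + generator A h x)"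
  by (auto simp: generator_def algebra_simps sum.distrib)

lemma generator_scale: "generator A (\<lambda>x. c * g x) = (\<lambda>x. c * generator A g x)"
  by (auto simp: generator_def algebra_simps sum_distrib_left)

text \<open>
  A linear map of a finite-dimensional space is bijective iff it is injective, so spectral values
  are eigenvalues. The functions on \<open>'e\<close> are identified with vectors to use this.
\<close>

lemma op_spectrum_generator_iff:
  fixes A :: "real ^ 'e::finite ^ 'e"
  shows "l \<in> op_spectrum (generator A) \<longleftrightarrow> (\<exists>g. g \<noteq> (\<lambda>_. 0) \<and> generator A g = (\<lambda>x. l * g x))"
proof -
  define B where "B = A - l *\<^sub>R mat 1"
  have eq: "(\<lambda>g x. generator A g x - l * g x) = vec_nth \<circ> (*v) B \<circ> vec_lambda"
  proof (intro ext)
    fix g :: "'e \<Rightarrow> real" and x :: 'e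
    have "(\<Sum>y\<in>UNIV. if x = y then l * g y else 0) = l * g x" by simp
    moreover have "(l * (if x = y then 1 else 0)) * g y = (if x = y then l * g y else 0)" for y by simp
    ultimately show "generator A g x - l * g x = (vec_nth \<circ> (*v) B \<circ> vec_lambda) g x"
      by (simp add: B_def generator_def matrix_vector_mult_def mat_def left_diff_distrib sum_subtractf)
  qed
  have inv: "vec_nth \<circ> vec_lambda = (id :: ('e \<Rightarrow> real) \<Rightarrow> _)" "vec_lambda \<circ> vec_nth = (id :: real ^ 'e \<Rightarrow> _)"
    by (simp_all add: fun_eq_iff)
  have b1: "bij (vec_nth :: real ^ 'e \<Rightarrow> _)" "bij (vec_lambda :: _ \<Rightarrow> real ^ 'e)"
    using o_bij[OF inv(2) inv(1)] o_bij[OF inv(1) inv(2)] by blast+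
  have "bij (vec_nth \<circ> (*v) B \<circ> vec_lambda) \<longleftrightarrow> bij ((*v) B)"
  proof
    assume a: "bij (vec_nth \<circ> (*v) B \<circ> vec_lambda)"
    have "(*v) B = vec_lambda \<circ> (vec_nth \<circ> (*v) B \<circ> vec_lambda) \<circ> vec_nth"
      by (auto simp: fun_eq_iff)
    then show "bij ((*v) B)" using a b1 by (metis bij_comp)
  qed (intro bij_comp b1)
  also have "\<dots> \<longleftrightarrow> inj ((*v) B)"
    using linear_injective_imp_surjective[OF matrix_vector_mul_linear[of B]] by (auto simp: bij_def)
  also have "\<dots> \<longleftrightarrow> (\<forall>v. B *v v = 0 \<longrightarrow> v = 0)"
    using linear_injective_0[OF matrix_vector_mul_linear[of B]] by auto
  finally have *: "l \<in> op_spectrum (generator A) \<longleftrightarrow> (\<exists>v. B *v v = 0 \<and> v \<noteq> 0)"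
    by (simp add: op_spectrum_def eq)
  have zero: "B *v v = 0 \<longleftrightarrow> generator A (vec_nth v) = (\<lambda>x. l * v $ x)" for v
    using fun_cong[OF eq, of "vec_nth v"] by (auto simp: vec_eq_iff fun_eq_iff)
  show ?thesis
  proof
    assume "l \<in> op_spectrum (generator A)"
    then obtain v where v: "B *v v = 0" "v \<noteq> 0" using * by blast
    have "vec_nth v \<noteq> (\<lambda>_. 0)" using v(2) by (auto simp: vec_eq_iff fun_eq_iff)
    then show "\<exists>g. g \<noteq> (\<lambda>_. 0) \<and> generator A g = (\<lambda>x. l * g x)"
      using v(1) zero by blast
  next
    assume "\<exists>g. g \<noteq> (\<lambda>_. 0) \<and> generator A g = (\<lambda>x. l * g x)"
    then obtain g where g: "g \<noteq> (\<lambda>_. 0)" "generator A g = (\<lambda>x. l * g x)" by blast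
    have "B *v (vec_lambda g) = 0" unfolding zero by (simp add: vec_lambda_inverse g(2))
    moreover have "vec_lambda g \<noteq> 0" using g(1) by (auto simp: vec_eq_iff fun_eq_iff)
    ultimately show "l \<in> op_spectrum (generator A)" using * by blast
  qed
qed

text \<open>
  Eigenvectors for distinct eigenvalues are orthogonal in \<open>L\<^sup>2(\<pi>)\<close>. Scaling by \<open>sqrt \<pi>\<close> makes them
  orthogonal in Euclidean space, where orthogonal families are finite. Finiteness is what makes the
  minimum in the definition of the spectral gap a genuine minimum.
\<close>

lemma finite_op_spectrum_self_adjoint:
  fixes A :: "real ^ 'e::finite ^ 'e"
  assumes pos: "\<And>x. 0 < pmf \<pi> x"
    and sym: "\<And>g h. l2_inner \<pi> (generator A g) h = l2_inner \<pi> g (generator A h)"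
  shows "finite (op_spectrum (generator A))"
proof -
  define ev where "ev l = (SOME g. g \<noteq> (\<lambda>_. 0) \<and> generator A g = (\<lambda>x. l * g x))" for l
  have ev: "ev l \<noteq> (\<lambda>_. 0)" "generator A (ev l) = (\<lambda>x. l * ev l x)" if "l \<in> op_spectrum (generator A)" for l
    using someI_ex[OF that[unfolded op_spectrum_generator_iff]] by (auto simp: ev_def)
  define vec where "vec l = (\<chi> x. sqrt (pmf \<pi> x) * ev l x)" for l
  have inner: "vec k \<bullet> vec l = l2_inner \<pi> (ev k) (ev l)" for k l
    unfolding vec_def inner_vec_def l2_inner_def
        by (intro sum.cong refl) (simp add: algebra_simps flip: power2_eq_square)
  have orth: "vec k \<bullet> vec l = 0" if "k \<in> op_spectrum (generator A)" "l \<in> op_spectrum (generator A)" "k \<noteq> l" for k l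
  proof -
    have "k * l2_inner \<pi> (ev k) (ev l) = l * l2_inner \<pi> (ev k) (ev l)"
      using sym[of "ev k" "ev l"] ev(2)[OF that(1)] ev(2)[OF that(2)]
      by (simp add: l2_inner_scale_left l2_inner_scale_right)
    then show ?thesis using that(3) by (simp add: inner)
  qed
  have nz: "vec l \<bullet> vec l \<noteq> 0" if "l \<in> op_spectrum (generator A)" for l
    using ev(1)[OF that] l2_inner_self_eq_0[OF pos, of "ev l"] by (auto simp only: inner fun_eq_iff)
  have "finite (vec ` op_spectrum (generator A))"
    by (rule pairwise_orthogonal_imp_finite) (auto simp: pairwise_def orthogonal_def intro!: orth)
  moreover have "inj_on vec (op_spectrum (generator A))"
  proof (rule inj_onI)
    fix k l assume "k \<in> op_spectrum (generator A)" "l \<in> op_spectrum (generator A)" "vec k = vec l"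
    then show "k = l" using orth[of k l] nz[of k] by auto
  qed
  ultimately show ?thesis by (rule finite_imageD)
qed

text \<open>
  First-order condition at a minimum: a quadratic polynomial without constant term that stays
  nonnegative has no linear term.
\<close>

lemma quadratic_nonneg_imp_linear_zero:
  fixes b c :: real
  assumes "\<And>e. 0 \<le> 2 * e * b + e * e * c"
  shows "b = 0"
proof (rule ccontr)
  assume "b \<noteq> 0"
  have c: "0 \<le> c" using assms[of 1] assms[of "-1"] by simp
  \<comment> \<open>The minimiser is \<open>- b / c\<close>; the shift by \<open>1\<close> avoids treating \<open>c = 0\<close> separately.\<close>
  let ?e = "- b / (c + 1)"
  have "2 * ?e * b + ?e * ?e * c = - (b * b) * (c + 2) / ((c + 1) * (c + 1))"
    using c by (simp add: divide_simps) (simp add: algebra_simps)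
  also have "\<dots> < 0" using \<open>b \<noteq> 0\<close> c by (intro divide_neg_pos mult_neg_pos)
      (auto simp: zero_less_mult_iff linorder_neq_iff)
  finally show False using assms[of ?e] by simp
qed

section \<open>The Poincare inequality\<close>

locale ergodic_rates =
  fixes \<pi> :: "'e::finite pmf" and Q :: "real ^ 'e ^ 'e"
  assumes rate_nonneg: "x \<noteq> y \<Longrightarrow> 0 \<le> Q $ x $ y"
    and row_sum: "(\<Sum>y\<in>UNIV. Q $ x $ y) = 0"
    and invariant: "invariant_distribution Q \<pi>"
    and transition_pos: "0 < t \<Longrightarrow> 0 < mat_exp (t *\<^sub>R Q) $ x $ y"
begin

lemma pi_pos: "0 < pmf \<pi> x"
proof -
  obtain z where z: "0 < pmf \<pi> z"
    using set_pmf_not_empty[of \<pi>] pmf_positive[of _ \<pi>] by blast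
  have "0 < pmf \<pi> z * mat_exp (1 *\<^sub>R Q) $ z $ x" using z transition_pos[of 1] by simp
  also have "\<dots> \<le> (\<Sum>z\<in>UNIV. pmf \<pi> z * mat_exp (1 *\<^sub>R Q) $ z $ x)"
    by (rule member_le_sum[of z UNIV "\<lambda>z. pmf \<pi> z * mat_exp (1 *\<^sub>R Q) $ z $ x"])
       (simp_all only: mult_nonneg_nonneg pmf_nonneg less_imp_le[OF transition_pos] zero_less_one UNIV_I finite)
  also have "\<dots> = pmf \<pi> x" by (rule mat_exp_fixes_invariant[OF invariant])
  finally show ?thesis .
qed

lemma generator_const: "generator Q (\<lambda>_. c) = (\<lambda>_. 0)"
  unfolding generator_def sum_distrib_right[symmetric] row_sum by simp

lemma l2_inner_one_generator: "l2_inner \<pi> (\<lambda>_. c) (generator Q g) = 0"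
proof -
  have "l2_inner \<pi> (\<lambda>_. c) (generator Q g) = (\<Sum>x\<in>UNIV. \<Sum>y\<in>UNIV. c * (pmf \<pi> x * Q $ x $ y * g y))"
    by (simp add: l2_inner_def generator_def sum_distrib_left sum_distrib_right algebra_simps)
  also have "\<dots> = (\<Sum>y\<in>UNIV. \<Sum>x\<in>UNIV. c * (pmf \<pi> x * Q $ x $ y * g y))" by (rule sum.swap)
  also have "\<dots> = (\<Sum>y\<in>UNIV. c * ((\<Sum>x\<in>UNIV. pmf \<pi> x * Q $ x $ y) * g y))"
    by (simp add: sum_distrib_left sum_distrib_right)
  also have "\<dots> = 0" using invariant by (simp add: invariant_distribution_def)
  finally show ?thesis .
qed

text \<open>
  Expanding the square, the two pure terms vanish because \<open>Q\<close> has zero row sums and because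
  \<open>\<pi> Q = 0\<close>.
\<close>

lemma Dirichlet_form:
  "l2_inner \<pi> g (generator Q g) = - (\<Sum>x\<in>UNIV. \<Sum>y\<in>UNIV. pmf \<pi> x * Q $ x $ y * (g x - g y)\<^sup>2) / 2"
proof -
  have 1: "(\<Sum>x\<in>UNIV. \<Sum>y\<in>UNIV. pmf \<pi> x * Q $ x $ y * (g x)\<^sup>2) = 0"
  proof -
    have "(\<Sum>y\<in>UNIV. pmf \<pi> x * Q $ x $ y * (g x)\<^sup>2) = pmf \<pi> x * (g x)\<^sup>2 * (\<Sum>y\<in>UNIV. Q $ x $ y)" for x
      by (simp only: sum_distrib_left) (simp add: algebra_simps)
    then show ?thesis by (simp add: row_sum)
  qed
  have 2: "(\<Sum>x\<in>UNIV. \<Sum>y\<in>UNIV. pmf \<pi> x * Q $ x $ y * (g y)\<^sup>2) = 0"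
    using l2_inner_one_generator[of 1 "\<lambda>y. (g y)\<^sup>2"]
    by (simp add: l2_inner_def generator_def sum_distrib_left sum_distrib_right algebra_simps)
  have 3: "(\<Sum>x\<in>UNIV. \<Sum>y\<in>UNIV. pmf \<pi> x * Q $ x $ y * (2 * g x * g y)) = 2 * l2_inner \<pi> g (generator Q g)"
    by (simp add: l2_inner_def generator_def sum_distrib_left sum_distrib_right algebra_simps)
  have "(\<Sum>x\<in>UNIV. \<Sum>y\<in>UNIV. pmf \<pi> x * Q $ x $ y * (g x - g y)\<^sup>2)
     = (\<Sum>x\<in>UNIV. \<Sum>y\<in>UNIV. pmf \<pi> x * Q $ x $ y * (g x)\<^sup>2) + (\<Sum>x\<in>UNIV. \<Sum>y\<in>UNIV. pmf \<pi> x * Q $ x $ y * (g y)\<^sup>2)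
      - (\<Sum>x\<in>UNIV. \<Sum>y\<in>UNIV. pmf \<pi> x * Q $ x $ y * (2 * g x * g y))"
    unfolding power2_diff by (simp only: sum.distrib sum_subtractf distrib_left right_diff_distrib)
  then show ?thesis using 1 2 3 by simp
qed

lemma Dirichlet_term_nonneg: "0 \<le> pmf \<pi> x * Q $ x $ y * (g x - g y)\<^sup>2"
  using rate_nonneg[of x y] by (cases "x = y") auto

lemma Dirichlet_nonpos: "l2_inner \<pi> g (generator Q g) \<le> 0"
  unfolding Dirichlet_form using Dirichlet_term_nonneg by (simp add: sum_nonneg)

text \<open>
  A maximum principle: such a \<open>g\<close> is fixed by \<open>exp Q\<close>, so its maximal value is an average of all
  its values with strictly positive weights.
\<close>

lemma kernel_generator_const:
  assumes "generator Q g = (\<lambda>_. 0)"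
  shows "g x = g y"
proof -
  have "Max (range g) \<in> range g" by (rule Max_in) auto
  then obtain m where "Max (range g) = g m" by blast
  then have m: "g z \<le> g m" for z using Max_ge[of "range g" "g z"] by simp
  have "g y = g m" for y
  proof (rule ccontr)
    assume "g y \<noteq> g m"
    let ?p = "\<lambda>z. mat_exp (1 *\<^sub>R Q) $ m $ z"
    have "g m = (\<Sum>z\<in>UNIV. ?p z * g z)"
      by (rule mat_exp_fixes_kernel[OF assms, symmetric])
    also have "\<dots> < (\<Sum>z\<in>UNIV. ?p z * g m)"
    proof (rule sum_strict_mono_ex1)
      have "?p y * g y < ?p y * g m"
        using \<open>g y \<noteq> g m\<close> m[of y] transition_pos[of 1 m y] by (simp add: less_le)
      then show "\<exists>z\<in>UNIV. ?p z * g z < ?p z * g m" by blast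
    qed (use transition_pos[of 1 m] m in \<open>auto intro!: mult_left_mono less_imp_le\<close>)
    also have "\<dots> = g m"
      by (rule mat_exp_fixes_kernel) (rule generator_const)
    finally show False by simp
  qed
  then show ?thesis by metis
qed

lemma Dirichlet_zero_imp_const:
  assumes "l2_inner \<pi> g (generator Q g) = 0"
  shows "g x = g y"
proof -
  have "(\<Sum>x\<in>UNIV. \<Sum>y\<in>UNIV. pmf \<pi> x * Q $ x $ y * (g x - g y)\<^sup>2) = 0"
    using assms unfolding Dirichlet_form by simp
  then have "pmf \<pi> x * Q $ x $ y * (g x - g y)\<^sup>2 = 0" for x y
    by (subst (asm) sum_nonneg_eq_0_iff)
       (auto intro!: sum_nonneg Dirichlet_term_nonneg simp: sum_nonneg_eq_0_iff Dirichlet_term_nonneg)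
  then have z: "Q $ x $ y * (g y - g x) = 0" for x y
    using pi_pos[of x] by (metis less_irrefl mult_eq_0_iff power_eq_0_iff right_minus_eq)
  have "generator Q g = (\<lambda>_. 0)"
  proof
    fix x
    have "generator Q g x = (\<Sum>y\<in>UNIV. Q $ x $ y * (g y - g x)) + (\<Sum>y\<in>UNIV. Q $ x $ y) * g x"
      by (simp add: generator_def algebra_simps sum_distrib_left flip: sum.distrib)
    then show "generator Q g x = 0" by (simp add: z row_sum)
  qed
  then show ?thesis by (rule kernel_generator_const)
qed

definition sym_rates :: "real ^ 'e ^ 'e" where
  "sym_rates = (1 / 2) *\<^sub>R (Q + time_reversal \<pi> Q)"

lemma generator_sym_rates:
  "generator sym_rates g = (\<lambda>x. (1 / 2) * (generator Q g x + generator (time_reversal \<pi> Q) g x))"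
  by (simp add: fun_eq_iff sym_rates_def generator_def algebra_simps sum.distrib sum_divide_distrib add_divide_distrib)

lemma sym_generator_eq: "sym_generator \<pi> Q = generator sym_rates"
  by (intro ext) (simp add: sym_generator_def l2_adjoint_generator[OF pi_pos] generator_sym_rates)

lemma l2_inner_sym_rates:
  "l2_inner \<pi> g (generator sym_rates h) = (l2_inner \<pi> g (generator Q h) + l2_inner \<pi> (generator Q g) h) / 2"
  unfolding generator_sym_rates l2_inner_scale_right l2_inner_add_right l2_inner_generator_left[OF pi_pos]
  by simp

lemma sym_rates_self_adjoint:
  "l2_inner \<pi> (generator sym_rates g) h = l2_inner \<pi> g (generator sym_rates h)"
  unfolding l2_inner_commute[of _ "generator sym_rates g"] l2_inner_sym_rates
  by (simp add: l2_inner_commute)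

text \<open>
  On the diagonal the antisymmetric part of \<open>Q\<close> drops out, so a spectral gap of the symmetrisation
  is a coercivity bound for \<open>Q\<close> itself.
\<close>

lemma sym_rates_quadratic: "l2_inner \<pi> g (generator sym_rates g) = l2_inner \<pi> g (generator Q g)"
  by (simp add: l2_inner_sym_rates l2_inner_commute)

text \<open>
  The Rayleigh quotient of \<open>- Q\<close> attains its minimum on the unit sphere of the orthogonal complement
  of the constants, which is compact; any non-zero \<open>h\<close> in that complement shows that the sphere is
  not empty.
\<close>

lemma Rayleigh_minimiser:
  assumes ex: "l2_inner \<pi> h (\<lambda>_. 1) = 0" "h \<noteq> (\<lambda>_. 0)"
  obtains k m where "l2_inner \<pi> k k = 1" "l2_inner \<pi> k (\<lambda>_. 1) = 0" "l2_inner \<pi> k (generator Q k) = - m"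
    "\<And>g. l2_inner \<pi> g (\<lambda>_. 1) = 0 \<Longrightarrow> l2_inner \<pi> g (generator Q g) \<le> - m * l2_inner \<pi> g g"
proof -
  define U where "U = {v :: real ^ 'e. l2_inner \<pi> (($) v) (($) v) = 1 \<and> l2_inner \<pi> (($) v) (\<lambda>_. 1) = 0}"
  define q where "q v = l2_inner \<pi> (($) v) (generator Q (($) v))" for v :: "real ^ 'e"
  have normalise: "\<exists>c>0. (\<chi> x. c * g x) \<in> U \<and> c * c * l2_inner \<pi> g g = 1"
    if "l2_inner \<pi> g (\<lambda>_. 1) = 0" "g \<noteq> (\<lambda>_. 0)" for g
  proof -
    have p: "0 < l2_inner \<pi> g g"
      using l2_inner_self_eq_0[OF pi_pos, of g] that(2) l2_inner_self_nonneg[of \<pi> g]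
          by (force simp: fun_eq_iff less_le)
    define c where "c = 1 / sqrt (l2_inner \<pi> g g)"
    have "c > 0" "c * c * l2_inner \<pi> g g = 1" using p by (auto simp: c_def)
    moreover have "l2_inner \<pi> (\<lambda>x. c * g x) (\<lambda>x. c * g x) = c * c * l2_inner \<pi> g g"
      "l2_inner \<pi> (\<lambda>x. c * g x) (\<lambda>_. 1) = 0"
      using that(1) by (simp_all only: l2_inner_scale_left l2_inner_scale_right mult.assoc mult_zero_right)
    moreover have "vec_nth (\<chi> x. c * g x) = (\<lambda>x. c * g x)" by (simp add: fun_eq_iff)
    ultimately show ?thesis unfolding U_def mem_Collect_eq by (intro exI[of _ c]) (simp only: simp_thms)
  qed
  have "bounded U"
  proof (rule boundedI)
    fix v assume v: "v \<in> U"
    have b: "\<bar>v $ x\<bar> \<le> 1 / sqrt (pmf \<pi> x)" for x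
    proof -
      have "v $ x * v $ x * pmf \<pi> x \<le> (\<Sum>x\<in>UNIV. v $ x * v $ x * pmf \<pi> x)"
        by (rule member_le_sum[of x UNIV "\<lambda>x. v $ x * v $ x * pmf \<pi> x"]) auto
      then have "(v $ x)\<^sup>2 * pmf \<pi> x \<le> 1" using v by (simp add: U_def l2_inner_def power2_eq_square)
      then have "(v $ x)\<^sup>2 \<le> 1 / pmf \<pi> x" using pi_pos[of x] by (simp add: field_simps)
      then have "sqrt ((v $ x)\<^sup>2) \<le> sqrt (1 / pmf \<pi> x)" by (rule real_sqrt_le_mono)
      then show ?thesis by (simp add: real_sqrt_divide)
    qed
    have "norm v \<le> (\<Sum>x\<in>UNIV. \<bar>v $ x\<bar>)" by (rule norm_le_l1_cart)
    also have "\<dots> \<le> (\<Sum>x\<in>UNIV. 1 / sqrt (pmf \<pi> x))" by (intro sum_mono b)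
    finally show "norm v \<le> (\<Sum>x\<in>UNIV. 1 / sqrt (pmf \<pi> x))" .
  qed
  moreover have "closed U"
    unfolding U_def l2_inner_def
    by (intro closed_Collect_conj closed_Collect_eq continuous_intros)
  ultimately have "compact U" by (simp add: compact_eq_bounded_closed)
  moreover have "U \<noteq> {}" using normalise[OF ex] by blast
  moreover have "continuous_on U q"
    unfolding q_def l2_inner_def generator_def by (intro continuous_intros)
  ultimately obtain v where v: "v \<in> U" "\<And>w. w \<in> U \<Longrightarrow> q w \<le> q v"
    using continuous_attains_sup[of U q] by blast
  show ?thesis
  proof (rule that[of "($) v" "- q v"])
    fix g assume g: "l2_inner \<pi> g (\<lambda>_. 1) = 0"
    show "l2_inner \<pi> g (generator Q g) \<le> - (- q v) * l2_inner \<pi> g g"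
    proof (cases "g = (\<lambda>_. 0)")
      case True
      then show ?thesis by (simp add: l2_inner_def)
    next
      case False
      then obtain c where c: "c > 0" "(\<chi> x. c * g x) \<in> U" "c * c * l2_inner \<pi> g g = 1"
        using normalise[OF g] by blast
      have "q (\<chi> x. c * g x) = c * c * l2_inner \<pi> g (generator Q g)"
        by (simp add: q_def vec_lambda_inverse generator_scale l2_inner_scale_left l2_inner_scale_right)
      then have "c * c * l2_inner \<pi> g (generator Q g)
          \<le> q v * (c * c * l2_inner \<pi> g g)" using v(2)[OF c(2)] c(3) by simp
      then have "(c * c) * l2_inner \<pi> g (generator Q g) \<le> (c * c) * (q v * l2_inner \<pi> g g)"
        by (simp add: algebra_simps)
      then show ?thesis using c(1) by (simp add: mult_le_cancel_left)
    qed
  qed (use v in \<open>auto simp: U_def q_def\<close>)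
qed

text \<open>
  Perturbing the minimiser in directions orthogonal to the constants shows that the residual
  \<open>z = S k + m k\<close>, with \<open>S\<close> the symmetrised generator, is orthogonal to all of
  them. But \<open>z\<close> is such a direction itself, hence zero, and \<open>k\<close> is an eigenvector.
\<close>

lemma Rayleigh_minimum_in_spectrum:
  assumes k: "l2_inner \<pi> k k = 1" "l2_inner \<pi> k (\<lambda>_. 1) = 0" "l2_inner \<pi> k (generator Q k) = - m"
    and min: "\<And>g. l2_inner \<pi> g (\<lambda>_. 1) = 0 \<Longrightarrow> l2_inner \<pi> g (generator Q g) \<le> - m * l2_inner \<pi> g g"
  shows "- m \<in> op_spectrum (sym_generator \<pi> Q)"
proof -
  define z where "z = (\<lambda>x. generator sym_rates k x + m * k x)"
  have z1: "l2_inner \<pi> z (\<lambda>_. 1) = 0"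
  proof -
    have "l2_inner \<pi> z (\<lambda>_. 1) = l2_inner \<pi> k (generator sym_rates (\<lambda>_. 1))"
      unfolding z_def l2_inner_add_left l2_inner_scale_left k(2) sym_rates_self_adjoint by simp
    also have "\<dots> = 0"
      unfolding l2_inner_sym_rates generator_const l2_inner_commute[of _ "generator Q k"] l2_inner_one_generator
      by (simp add: l2_inner_def)
    finally show ?thesis .
  qed
  have zw: "l2_inner \<pi> z w = 0" if w: "l2_inner \<pi> w (\<lambda>_. 1) = 0" for w
  proof -
    have "0 \<le> 2 * e * (- l2_inner \<pi> z w)
        + e * e * (- m * l2_inner \<pi> w w - l2_inner \<pi> w (generator sym_rates w))" for e
    proof -
      let ?S = "generator sym_rates" and ?g = "\<lambda>x. k x + e * w x"
      have g1: "l2_inner \<pi> ?g (\<lambda>_. 1) = 0"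
        unfolding l2_inner_add_left l2_inner_scale_left k(2) w by simp
      have min_g: "l2_inner \<pi> ?g (?S ?g) \<le> - m * l2_inner \<pi> ?g ?g"
        unfolding sym_rates_quadratic by (rule min[OF g1])
      have kSk: "l2_inner \<pi> k (?S k) = - m" unfolding sym_rates_quadratic by (rule k(3))
      have gSg: "l2_inner \<pi> ?g (?S ?g) = - m + 2 * e * l2_inner \<pi> (?S k) w + e * e * l2_inner \<pi> w (?S w)"
        unfolding generator_add generator_scale l2_inner_add_left l2_inner_add_right
          l2_inner_scale_left l2_inner_scale_right kSk
          sym_rates_self_adjoint[of k w, symmetric] l2_inner_commute[of _ w "?S k"]
        by (simp add: algebra_simps)
      have gg: "l2_inner \<pi> ?g ?g = 1 + 2 * e * l2_inner \<pi> k w + e * e * l2_inner \<pi> w w"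
        unfolding l2_inner_add_left l2_inner_add_right
          l2_inner_scale_left l2_inner_scale_right k(1) l2_inner_commute[of _ w k]
        by (simp add: algebra_simps)
      have zw: "l2_inner \<pi> z w = l2_inner \<pi> (?S k) w + m * l2_inner \<pi> k w"
        unfolding z_def l2_inner_add_left l2_inner_scale_left ..
      show ?thesis using min_g unfolding gSg gg zw by (simp add: algebra_simps)
    qed
    then have "- l2_inner \<pi> z w = 0" by (rule quadratic_nonneg_imp_linear_zero)
    then show ?thesis by simp
  qed
  have "z x = 0" for x using l2_inner_self_eq_0[OF pi_pos zw[OF z1]] .
  then have "generator sym_rates k = (\<lambda>x. - m * k x)" by (auto simp: z_def fun_eq_iff add_eq_0_iff)
  moreover have "k \<noteq> (\<lambda>_. 0)" using k(1) by (auto simp: l2_inner_def)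
  ultimately show ?thesis unfolding sym_generator_eq op_spectrum_generator_iff by blast
qed

text \<open>
  The Rayleigh minimum \<open>m\<close> is non-zero by irreducibility, so \<open>- m\<close> is one of the eigenvalues over which
  the spectral gap is minimised. The gap is therefore at most \<open>m\<close>, and being attained at some
  non-zero eigenvalue it is positive.
\<close>

lemma spectral_gap:
  assumes ex: "l2_inner \<pi> h (\<lambda>_. 1) = 0" "h \<noteq> (\<lambda>_. 0)"
  shows spectral_gap_pos: "0 < spectral_gap \<pi> Q"
    and Poincare: "l2_inner \<pi> g (\<lambda>_. 1) = 0 \<Longrightarrow> l2_inner \<pi> g (generator Q g) \<le> - spectral_gap \<pi> Q * l2_inner \<pi> g g"
proof -
  obtain k m where km: "l2_inner \<pi> k k = 1" "l2_inner \<pi> k (\<lambda>_. 1) = 0" "l2_inner \<pi> k (generator Q k) = - m"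
    "\<And>g. l2_inner \<pi> g (\<lambda>_. 1) = 0 \<Longrightarrow> l2_inner \<pi> g (generator Q g) \<le> - m * l2_inner \<pi> g g"
    by (rule Rayleigh_minimiser[OF ex]) (rule that)
  let ?S = "{\<bar>l\<bar> | l. l \<in> op_spectrum (sym_generator \<pi> Q) - {0}}"
  have "finite (op_spectrum (sym_generator \<pi> Q))"
    unfolding sym_generator_eq by (rule finite_op_spectrum_self_adjoint[OF pi_pos sym_rates_self_adjoint])
  then have fin: "finite ?S" by auto
  have "m \<noteq> 0"
  proof
    assume "m = 0"
    then have "k x = k y" for x y using km(3) by (intro Dirichlet_zero_imp_const) simp
    then obtain c where "k = (\<lambda>_. c)" by metis
    with km(2) l2_inner_scale_left[of \<pi> c "\<lambda>_. 1" "\<lambda>_. 1"] have "c = 0"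
      by (simp add: l2_inner_one)
    with \<open>k = (\<lambda>_. c)\<close> km(1) show False by (simp add: l2_inner_def)
  qed
  moreover have "0 \<le> m" using Dirichlet_nonpos[of k] km(3) by simp
  ultimately have m: "m \<in> ?S"
    using Rayleigh_minimum_in_spectrum[OF km] by (auto intro!: exI[of _ "- m"])
  have "spectral_gap \<pi> Q \<in> ?S" unfolding spectral_gap_def using fin m by (intro Min_in) auto
  then show "0 < spectral_gap \<pi> Q" by auto
  have "spectral_gap \<pi> Q \<le> m" unfolding spectral_gap_def using fin m by (rule Min_le)
  then have "- m * l2_inner \<pi> g g \<le> - spectral_gap \<pi> Q * l2_inner \<pi> g g"
    by (intro mult_right_mono l2_inner_self_nonneg) simp
  then show "l2_inner \<pi> g (generator Q g) \<le> - spectral_gap \<pi> Q * l2_inner \<pi> g g" if "l2_inner \<pi> g (\<lambda>_. 1) = 0"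
    using km(4)[OF that] by linarith
qed

end

section \<open>The generator perturbed by a potential\<close>

context ergodic_rates
begin

text \<open>
  Split \<open>g = h + a\<close> with \<open>a\<close> constant and \<open>h\<close> orthogonal to the constants, and let \<open>N\<close> be the norm
  of \<open>h\<close>. The form of \<open>Q\<close> sees only \<open>h\<close> and contributes at most \<open>- spectral_gap \<sqdot> N\<^sup>2\<close>. The potential
  contributes nothing on \<open>a\<close> because \<open>f\<close> is centred, a cross term bounded by Cauchy-Schwarz, and at
  most \<open>r m N\<^sup>2\<close> on \<open>h\<close>. Completing the square in \<open>N\<close> removes the cross term.
\<close>

lemma perturbed_form_bound:
  assumes f: "l2_inner \<pi> f (\<lambda>_. 1) = 0" "f \<noteq> (\<lambda>_. 0)" "\<And>x. \<bar>f x\<bar> \<le> m"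
    and r: "0 \<le> r" "r * m < spectral_gap \<pi> Q"
  shows "l2_inner \<pi> g (\<lambda>x. generator Q g x + r * (f x * g x))
    \<le> r\<^sup>2 * l2_inner \<pi> f f / (spectral_gap \<pi> Q - r * m) * l2_inner \<pi> g g"
proof -
  define a where "a = l2_inner \<pi> g (\<lambda>_. 1)"
  define h where "h = (\<lambda>x. g x + - a * 1)"
  define D where "D = spectral_gap \<pi> Q - r * m"
  define F where "F = l2_norm \<pi> f"
  define N where "N = l2_norm \<pi> h"
  have D: "0 < D" using r by (simp add: D_def)
  have g: "g = (\<lambda>x. h x + a * 1)" by (simp add: h_def)
  have h1: "l2_inner \<pi> h (\<lambda>_. 1) = 0"
    unfolding h_def l2_inner_add_left l2_inner_scale_left l2_inner_one a_def[symmetric] by simp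
  have gg: "l2_inner \<pi> g g = N\<^sup>2 + a\<^sup>2"
    unfolding g l2_inner_add_left l2_inner_scale_left l2_inner_add_right l2_inner_scale_right
      l2_inner_one h1 l2_inner_commute[of \<pi> "\<lambda>_. 1" h] N_def l2_norm_power2
    by (simp add: power2_eq_square)
  have "generator Q g = generator Q h"
    unfolding g generator_add using generator_const[of "a * 1"] by simp
  then have gL: "l2_inner \<pi> g (generator Q g) \<le> - spectral_gap \<pi> Q * N\<^sup>2"
    using Poincare[OF f(1,2) h1]
    unfolding N_def l2_norm_power2 by (simp add: g l2_inner_add_left l2_inner_one_generator)
  have fg: "l2_inner \<pi> g (\<lambda>x. f x * g x) = 2 * a * l2_inner \<pi> f h + l2_inner \<pi> h (\<lambda>x. f x * h x)"
  proof -
    have "l2_inner \<pi> g (\<lambda>x. f x * g x)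
        = a\<^sup>2 * l2_inner \<pi> f (\<lambda>_. 1) + 2 * a * l2_inner \<pi> f h + l2_inner \<pi> h (\<lambda>x. f x * h x)"
      unfolding g l2_inner_def sum_distrib_left sum.distrib[symmetric]
      by (intro sum.cong refl) (simp add: power2_eq_square algebra_simps)
    then show ?thesis by (simp add: f(1))
  qed
  have hfh: "l2_inner \<pi> h (\<lambda>x. f x * h x) \<le> m * N\<^sup>2"
    unfolding N_def l2_norm_power2 l2_inner_def sum_distrib_left
  proof (intro sum_mono)
    fix x
    have "f x * (h x * h x * pmf \<pi> x) \<le> m * (h x * h x * pmf \<pi> x)"
      using f(3)[of x] by (intro mult_right_mono) (auto simp: abs_le_iff)
    then show "h x * (f x * h x) * pmf \<pi> x \<le> m * (h x * h x * pmf \<pi> x)" by (simp add: algebra_simps)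
  qed
  have "2 * a * l2_inner \<pi> f h \<le> \<bar>2 * a * l2_inner \<pi> f h\<bar>" by (rule abs_ge_self)
  also have "\<dots> = 2 * \<bar>a\<bar> * \<bar>l2_inner \<pi> f h\<bar>" by (simp add: abs_mult)
  also have "\<dots> \<le> 2 * \<bar>a\<bar> * (F * N)"
    unfolding F_def N_def by (intro mult_left_mono l2_Cauchy_Schwarz) auto
  finally have cross: "r * (2 * a * l2_inner \<pi> f h) \<le> r * (2 * \<bar>a\<bar> * (F * N))"
    using r(1) by (rule mult_left_mono)
  have "l2_inner \<pi> g (\<lambda>x. generator Q g x + r * (f x * g x))
      = l2_inner \<pi> g (generator Q g) + r * (2 * a * l2_inner \<pi> f h) + r * l2_inner \<pi> h (\<lambda>x. f x * h x)"
    unfolding l2_inner_add_right l2_inner_scale_right fg by (simp add: algebra_simps)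
  also have "\<dots> \<le> - spectral_gap \<pi> Q * N\<^sup>2 + r * (2 * \<bar>a\<bar> * (F * N)) + r * (m * N\<^sup>2)"
    by (intro add_mono gL cross mult_left_mono hfh r(1))
  also have "\<dots> = 2 * (r * \<bar>a\<bar> * F) * N - D * N\<^sup>2" by (simp add: D_def algebra_simps)
  also have "\<dots> \<le> (r * \<bar>a\<bar> * F)\<^sup>2 / D"
  proof -
    have "0 \<le> (r * \<bar>a\<bar> * F - D * N)\<^sup>2" by simp
    then have "(2 * (r * \<bar>a\<bar> * F) * N - D * N\<^sup>2) * D \<le> (r * \<bar>a\<bar> * F)\<^sup>2"
      unfolding power2_diff by (simp add: power2_eq_square algebra_simps)
    then show ?thesis using D by (simp add: pos_le_divide_eq)
  qed
  also have "\<dots> = r\<^sup>2 * F\<^sup>2 / D * a\<^sup>2" by (simp add: power_mult_distrib)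
  also have "\<dots> \<le> r\<^sup>2 * F\<^sup>2 / D * (N\<^sup>2 + a\<^sup>2)"
    using D by (intro mult_left_mono) auto
  finally show ?thesis unfolding gg D_def F_def l2_norm_power2 .
qed

end

section \<open>Growth of iterated kernels close to the identity\<close>

lemma l2_inner_generator_Gram:
  "l2_inner \<pi> (generator K g) (generator K g)
    = (\<Sum>x\<in>UNIV. \<Sum>y\<in>UNIV. g x * g y * (\<Sum>z\<in>UNIV. pmf \<pi> z * K $ z $ x * K $ z $ y))"
proof -
  have "l2_inner \<pi> (generator K g) (generator K g)
      = (\<Sum>z\<in>UNIV. \<Sum>x\<in>UNIV. \<Sum>y\<in>UNIV. g x * g y * (pmf \<pi> z * K $ z $ x * K $ z $ y))"
    unfolding l2_inner_def generator_def
    unfolding sum_product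
    unfolding sum_distrib_right
    by (intro sum.cong refl) (simp add: algebra_simps)
  also have "\<dots> = (\<Sum>x\<in>UNIV. \<Sum>z\<in>UNIV. \<Sum>y\<in>UNIV. g x * g y * (pmf \<pi> z * K $ z $ x * K $ z $ y))"
    by (rule sum.swap)
  also have "\<dots> = (\<Sum>x\<in>UNIV. \<Sum>y\<in>UNIV. \<Sum>z\<in>UNIV. g x * g y * (pmf \<pi> z * K $ z $ x * K $ z $ y))"
    by (intro sum.cong refl sum.swap)
  finally show ?thesis by (simp add: sum_distrib_left)
qed

lemma l1_le_l2_inner:
  assumes "\<And>x. 0 < pmf \<pi> x"
  shows "(\<Sum>x\<in>UNIV. \<bar>g x\<bar>)\<^sup>2 \<le> (\<Sum>x\<in>UNIV. 1 / pmf \<pi> x) * l2_inner \<pi> g g"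
proof -
  let ?s = "\<lambda>x. sqrt (pmf \<pi> x)"
  have "(\<Sum>x\<in>UNIV. (1 / ?s x) * (\<bar>g x\<bar> * ?s x))\<^sup>2
      \<le> (\<Sum>x\<in>UNIV. (1 / ?s x)\<^sup>2) * (\<Sum>x\<in>UNIV. (\<bar>g x\<bar> * ?s x)\<^sup>2)"
    by (rule Cauchy_Schwarz_ineq_sum)
  also have "(\<Sum>x\<in>UNIV. (1 / ?s x) * (\<bar>g x\<bar> * ?s x)) = (\<Sum>x\<in>UNIV. \<bar>g x\<bar>)"
    using assms by (intro sum.cong refl) (simp add: less_le)
  also have "(\<Sum>x\<in>UNIV. (1 / ?s x)\<^sup>2) = (\<Sum>x\<in>UNIV. 1 / pmf \<pi> x)"
    by (simp add: power_divide)
  also have "(\<Sum>x\<in>UNIV. (\<bar>g x\<bar> * ?s x)\<^sup>2) = l2_inner \<pi> g g"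
    by (simp add: l2_inner_def power_mult_distrib) (simp add: power2_eq_square)
  finally show ?thesis .
qed

text \<open>
  The form of \<open>A\<close> controls the norm of a kernel \<open>K h = 1 + h A + o(h)\<close> to first order, because
  \<open>\<parallel>K h g\<parallel>\<^sup>2 = \<parallel>g\<parallel>\<^sup>2 + 2 h \<langle>g, A g\<rangle> + o(h)\<close>. To have the error term uniform in \<open>g\<close>, the expansion
  is made for the finitely many entries \<open>G x y h\<close> of the Gram matrix of \<open>K h\<close>; a bound \<open>h d\<close> on
  each entry's error costs at most \<open>h d C \<parallel>g\<parallel>\<^sup>2\<close>, where \<open>C\<close> is the constant of \<open>l1_le_l2_inner\<close>.
\<close>

lemma one_step_growth:
  fixes K :: "real \<Rightarrow> real ^ 'e::finite ^ 'e"
  assumes pos: "\<And>x. 0 < pmf \<pi> x"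
    and K0: "K 0 = mat 1"
    and deriv: "\<And>x y. ((\<lambda>h. K h $ x $ y) has_field_derivative A $ x $ y) (at 0)"
    and form: "\<And>g. l2_inner \<pi> g (generator A g) \<le> c * l2_inner \<pi> g g"
    and e: "0 < e"
  shows "\<forall>\<^sub>F h in at_right 0. \<forall>g. l2_norm \<pi> (generator (K h) g) \<le> exp (h * (c + e)) * l2_norm \<pi> g"
proof -
  define G where "G x y h = (\<Sum>z\<in>UNIV. pmf \<pi> z * K h $ z $ x * K h $ z $ y)" for x y h
  define G' where "G' x y = pmf \<pi> y * A $ y $ x + pmf \<pi> x * A $ x $ y" for x y
  define C where "C = (\<Sum>x\<in>UNIV. 1 / pmf \<pi> x)"
  \<comment> \<open>Chosen so that the total error is \<open>2 h e\<close> times the squared norm.\<close>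
  define d where "d = 2 * e / C"
  have C: "0 < C" unfolding C_def using pos by (intro sum_pos) auto
  have d: "0 < d" using C e by (simp add: d_def)
  have G: "(G x y has_field_derivative G' x y) (at 0)" for x y
  proof -
    have "(G x y has_field_derivative (\<Sum>z\<in>UNIV. pmf \<pi> z * A $ z $ x * K 0 $ z $ y
        + A $ z $ y * (pmf \<pi> z * K 0 $ z $ x))) (at 0)"
      unfolding G_def by (intro DERIV_sum DERIV_mult DERIV_cmult deriv)
    also have "(\<Sum>z\<in>UNIV. pmf \<pi> z * A $ z $ x * K 0 $ z $ y + A $ z $ y * (pmf \<pi> z * K 0 $ z $ x))
      = (\<Sum>z\<in>UNIV. if z = y then pmf \<pi> z * A $ z $ x else 0) + (\<Sum>z\<in>UNIV. if z = x then pmf \<pi> z * A $ z $ y else 0)"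
      unfolding sum.distrib[symmetric] by (intro sum.cong refl) (auto simp: K0 mat_def)
    also have "\<dots> = G' x y" by (simp add: G'_def)
    finally show ?thesis .
  qed
  have "\<forall>\<^sub>F h in at 0. \<forall>x y. \<bar>(G x y h - G x y 0) / h - G' x y\<bar> < d"
  proof (intro eventually_all_finite)
    fix x y
    show "\<forall>\<^sub>F h in at 0. \<bar>(G x y h - G x y 0) / h - G' x y\<bar> < d"
      using tendstoD[OF G[of x y, unfolded DERIV_def] d] by (simp add: dist_real_def)
  qed
  then have "\<forall>\<^sub>F h in at_right 0. \<forall>x y. \<bar>(G x y h - G x y 0) / h - G' x y\<bar> < d"
    by (rule filter_leD[OF at_le, rotated]) simp
  then show ?thesis using eventually_at_right_less[of 0]
  proof eventually_elim
    case (elim h)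
    have R: "G x y h = G x y 0 + h * G' x y + (G x y h - G x y 0 - h * G' x y)"
      "\<bar>G x y h - G x y 0 - h * G' x y\<bar> \<le> h * d" for x y
    proof -
      have "G x y h - G x y 0 - h * G' x y = h * ((G x y h - G x y 0) / h - G' x y)"
        using elim(2) by (simp add: field_simps)
      then have "\<bar>G x y h - G x y 0 - h * G' x y\<bar> = h * \<bar>(G x y h - G x y 0) / h - G' x y\<bar>"
        using elim(2) by (simp only: abs_mult abs_of_pos)
      also have "\<dots> \<le> h * d" using elim by (intro mult_left_mono) (auto intro: less_imp_le)
      finally show "\<bar>G x y h - G x y 0 - h * G' x y\<bar> \<le> h * d" .
    qed simp
    show ?case
    proof
      fix g :: "'e \<Rightarrow> real"
      have G0: "(\<Sum>x\<in>UNIV. \<Sum>y\<in>UNIV. g x * g y * G x y 0) = l2_inner \<pi> g g"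
      proof -
        have "generator (mat 1) g x = (\<Sum>y\<in>UNIV. if x = y then g y else 0)" for x
          unfolding generator_def by (intro sum.cong refl) (auto simp: mat_def)
        then have "generator (K 0) g = g" by (intro ext) (simp add: K0)
        then show ?thesis using l2_inner_generator_Gram[of \<pi> "K 0" g] by (simp add: G_def)
      qed
      have G1: "(\<Sum>x\<in>UNIV. \<Sum>y\<in>UNIV. g x * g y * G' x y) = 2 * l2_inner \<pi> g (generator A g)"
      proof -
        have "(\<Sum>x\<in>UNIV. \<Sum>y\<in>UNIV. g x * g y * G' x y)
            = (\<Sum>x\<in>UNIV. \<Sum>y\<in>UNIV. g x * g y * (pmf \<pi> y * A $ y $ x)) +
                (\<Sum>x\<in>UNIV. \<Sum>y\<in>UNIV. g x * g y * (pmf \<pi> x * A $ x $ y))"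
          by (simp add: G'_def distrib_left sum.distrib)
        also have "(\<Sum>x\<in>UNIV. \<Sum>y\<in>UNIV. g x * g y * (pmf \<pi> y * A $ y $ x))
            = (\<Sum>y\<in>UNIV. \<Sum>x\<in>UNIV. g x * g y * (pmf \<pi> y * A $ y $ x))"
          by (rule sum.swap)
        also have "\<dots> = l2_inner \<pi> g (generator A g)"
          unfolding l2_inner_def generator_def sum_distrib_left sum_distrib_right
          by (intro sum.cong refl) (simp add: algebra_simps)
        also have "(\<Sum>x\<in>UNIV. \<Sum>y\<in>UNIV. g x * g y * (pmf \<pi> x * A $ x $ y)) = l2_inner \<pi> g (generator A g)"
          unfolding l2_inner_def generator_def sum_distrib_left sum_distrib_right
          by (intro sum.cong refl) (simp add: algebra_simps)
        finally show ?thesis by simp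
      qed
      have "(\<Sum>x\<in>UNIV. \<Sum>y\<in>UNIV. g x * g y * (G x y h - G x y 0 - h * G' x y))
          \<le> (\<Sum>x\<in>UNIV. \<Sum>y\<in>UNIV. \<bar>g x\<bar> * \<bar>g y\<bar> * (h * d))"
      proof (intro sum_mono)
        fix x y
        have "g x * g y * (G x y h - G x y 0 - h * G' x y) \<le> \<bar>g x * g y * (G x y h - G x y 0 - h * G' x y)\<bar>"
          by (rule abs_ge_self)
        also have "\<dots> \<le> \<bar>g x\<bar> * \<bar>g y\<bar> * (h * d)"
          unfolding abs_mult by (intro mult_left_mono R(2)) auto
        finally show "g x * g y * (G x y h - G x y 0 - h * G' x y) \<le> \<bar>g x\<bar> * \<bar>g y\<bar> * (h * d)" .
      qed
      also have "\<dots> = h * d * (\<Sum>x\<in>UNIV. \<bar>g x\<bar>)\<^sup>2"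
        unfolding power2_eq_square
        unfolding sum_product
        unfolding sum_distrib_left by (simp add: algebra_simps)
      also have "\<dots> \<le> h * d * (C * l2_inner \<pi> g g)"
        unfolding C_def using elim(2) d by (intro mult_left_mono l1_le_l2_inner pos) auto
      also have "\<dots> = 2 * h * e * l2_inner \<pi> g g" using C by (simp add: d_def)
      finally have R_sum: "(\<Sum>x\<in>UNIV. \<Sum>y\<in>UNIV. g x * g y * (G x y h - G x y 0 - h * G' x y))
          \<le> 2 * h * e * l2_inner \<pi> g g" .
      have "l2_inner \<pi> (generator (K h) g) (generator (K h) g) = (\<Sum>x\<in>UNIV. \<Sum>y\<in>UNIV. g x * g y * G x y h)"
        by (simp add: l2_inner_generator_Gram G_def)
      also have "\<dots> = (\<Sum>x\<in>UNIV. \<Sum>y\<in>UNIV. g x * g y * G x y 0) + h * (\<Sum>x\<in>UNIV. \<Sum>y\<in>UNIV. g x * g y * G' x y)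
          + (\<Sum>x\<in>UNIV. \<Sum>y\<in>UNIV. g x * g y * (G x y h - G x y 0 - h * G' x y))"
        unfolding sum_distrib_left sum.distrib[symmetric] by (intro sum.cong refl) (simp add: algebra_simps)
      also have "\<dots> \<le> l2_inner \<pi> g g + h * (2 * (c * l2_inner \<pi> g g)) + 2 * h * e * l2_inner \<pi> g g"
        unfolding G0 G1 using elim(2) by (intro add_mono R_sum mult_left_mono form order_refl) auto
      also have "\<dots> = (1 + 2 * (h * (c + e))) * l2_inner \<pi> g g" by (simp add: algebra_simps)
      also have "\<dots> \<le> exp (2 * (h * (c + e))) * l2_inner \<pi> g g"
        by (intro mult_right_mono l2_inner_self_nonneg exp_ge_add_one_self)
      also have "\<dots> = (exp (h * (c + e)) * l2_norm \<pi> g)\<^sup>2"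
        by (simp add: power_mult_distrib l2_norm_power2 flip: exp_double)
      finally have "(l2_norm \<pi> (generator (K h) g))\<^sup>2 \<le> (exp (h * (c + e)) * l2_norm \<pi> g)\<^sup>2"
        by (simp add: l2_norm_power2)
      then show "l2_norm \<pi> (generator (K h) g) \<le> exp (h * (c + e)) * l2_norm \<pi> g"
        by (rule power2_le_imp_le) (simp add: l2_norm_nonneg)
    qed
  qed
qed

text \<open>
  The exponents of \<open>n\<close> steps of length \<open>t / n\<close> add up to \<open>t (c + e)\<close>.
  In the limit this is the growth bound of the semigroup \<open>exp (t A)\<close>.
\<close>

lemma n_step_growth:
  fixes K :: "real \<Rightarrow> real ^ 'e::finite ^ 'e"
  assumes "\<And>x. 0 < pmf \<pi> x"
    and "K 0 = mat 1"
    and "\<And>x y. ((\<lambda>h. K h $ x $ y) has_field_derivative A $ x $ y) (at 0)"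
    and "\<And>g. l2_inner \<pi> g (generator A g) \<le> c * l2_inner \<pi> g g"
    and "0 < e" and t: "0 < t"
  shows "\<forall>\<^sub>F n in sequentially. \<forall>g. l2_norm \<pi> ((generator (K (t / real n)) ^^ n) g)
      \<le> exp (t * (c + e)) * l2_norm \<pi> g"
proof -
  have "filterlim (\<lambda>n. t / real n) (at_right 0) sequentially"
    using t by real_asymp
  from eventually_compose_filterlim[OF one_step_growth[OF assms(1-5)] this]
  show ?thesis using eventually_gt_at_top[of 0]
  proof eventually_elim
    case (elim n)
    let ?h = "t / real n" and ?T = "generator (K (t / real n))"
    have "l2_norm \<pi> ((?T ^^ k) g) \<le> exp (real k * (?h * (c + e))) * l2_norm \<pi> g" for k g
    proof (induction k)
      case (Suc k)
      have "l2_norm \<pi> ((?T ^^ Suc k) g) \<le> exp (?h * (c + e)) * l2_norm \<pi> ((?T ^^ k) g)"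
        using elim(1) by simp
      also have "\<dots> \<le> exp (?h * (c + e)) * (exp (real k * (?h * (c + e))) * l2_norm \<pi> g)"
        by (intro mult_left_mono Suc.IH) simp
      also have "\<dots> = exp (?h * (c + e) + real k * (?h * (c + e))) * l2_norm \<pi> g"
        unfolding exp_add by simp
      also have "?h * (c + e) + real k * (?h * (c + e)) = real (Suc k) * (?h * (c + e))"
        by (simp only: of_nat_Suc distrib_right mult_1)
      finally show ?case .
    qed simp
    from this[of n] show ?case using elim(2) by simp
  qed
qed

section \<open>Exponential moments along a Markov jump process\<close>

context markov_jump_process
begin

lemma space_P: "space (P x) = space M"
  using sets_P by (rule sets_eq_imp_space_eq)

lemma measurable_P: "measurable (P x) N = measurable M N"
  by (rule measurable_cong_sets[OF sets_P refl])

lemma measurable_state: "0 \<le> t \<Longrightarrow> (\<lambda>\<omega>. g (X t \<omega>)) \<in> measurable (P x) (borel :: real measure)"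
  unfolding measurable_P by (rule measurable_compose[OF measurable_X]) simp_all

lemma space_past: "space (past M X s) = space M"
  unfolding past_def by (rule space_measure_of) auto

lemma sets_past: "sets (past M X s) = sigma_sets (space M) {X r -` {y} \<inter> space M | r y. 0 \<le> r \<and> r \<le> s}"
  unfolding past_def by (rule sets_measure_of) auto

lemma measurable_past:
  assumes "0 \<le> r" "r \<le> s"
  shows "X r \<in> measurable (past M X s) (count_space UNIV)"
  using assms by (auto simp: measurable_count_space_eq2_countable space_past sets_past intro!: sigma_sets.Basic)

lemma subalgebra_past: "subalgebra (P x) (past M X s)"
  unfolding subalgebra_def space_past space_P sets_past sets_P
proof (intro conjI refl sets.sigma_sets_subset subsetI)
  fix A assume "A \<in> {X r -` {y} \<inter> space M | r y. 0 \<le> r \<and> r \<le> s}"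
  then show "A \<in> sets M" by (auto intro!: measurable_sets[OF measurable_X])
qed

lemma integrable_bounded:
  assumes "Z \<in> borel_measurable (P x)" "\<And>\<omega>. \<omega> \<in> space M \<Longrightarrow> \<bar>Z \<omega>\<bar> \<le> (B::real)"
  shows "integrable (P x) Z"
proof -
  interpret prob_space "P x" by (rule prob)
  show ?thesis using assms by (intro integrable_const_bound[of Z B]) (auto simp: space_P)
qed

text \<open>
  The Markov property is assumed for the indicator of a single state at one later time. By linearity
  it extends to functions of that state, weighted by a bounded function of the past.
\<close>

lemma expectation_Markov_step:
  assumes s: "0 \<le> s" and h: "0 \<le> h"
    and Z: "Z \<in> borel_measurable (past M X s)" "\<And>\<omega>. \<omega> \<in> space M \<Longrightarrow> \<bar>Z \<omega>\<bar> \<le> B"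
  shows "(\<integral>\<omega>. Z \<omega> * g (X (s + h) \<omega>) \<partial>P x)
    = (\<integral>\<omega>. Z \<omega> * (\<Sum>z\<in>UNIV. transition P X h (X s \<omega>) z * g z) \<partial>P x)"
proof -
  interpret prob_space "P x" by (rule prob)
  interpret finite_measure_subalgebra "P x" "past M X s"
    by (unfold_locales) (rule subalgebra_past)
  have [measurable]: "Z \<in> borel_measurable (P x)"
    by (rule measurable_from_subalg[OF subalgebra_past Z(1)])
  let ?I = "\<lambda>z. indicator {\<omega> \<in> space M. X (s + h) \<omega> = z} :: 'w \<Rightarrow> real"
  have sets: "{\<omega> \<in> space M. X (s + h) \<omega> = z} \<in> sets (P x)" for z
  proof -
    have "X (s + h) -` {z} \<inter> space M \<in> sets M"
      using s h by (intro measurable_sets[OF measurable_X]) auto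
    also have "X (s + h) -` {z} \<inter> space M = {\<omega> \<in> space M. X (s + h) \<omega> = z}" by auto
    finally show ?thesis by (simp add: sets_P)
  qed
  have [measurable]: "?I z \<in> borel_measurable (P x)" for z using sets by simp
  have int: "integrable (P x) (\<lambda>\<omega>. Z \<omega> * ?I z \<omega>)" for z
  proof (rule integrable_bounded)
    show "(\<lambda>\<omega>. Z \<omega> * ?I z \<omega>) \<in> borel_measurable (P x)" by measurable
    show "\<bar>Z \<omega> * ?I z \<omega>\<bar> \<le> B" if "\<omega> \<in> space M" for \<omega>
      using Z(2)[OF that] order_trans[OF abs_ge_zero Z(2)[OF that]] by (simp add: indicator_def)
  qed
  have [measurable]: "(\<lambda>\<omega>. transition P X h (X s \<omega>) z) \<in> borel_measurable (P x)" for z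
    by (rule measurable_state[OF s])
  have eq: "(\<integral>\<omega>. Z \<omega> * ?I z \<omega> \<partial>P x) = (\<integral>\<omega>. Z \<omega> * transition P X h (X s \<omega>) z \<partial>P x)"
    and int': "integrable (P x) (\<lambda>\<omega>. Z \<omega> * transition P X h (X s \<omega>) z)" for z
  proof -
    note ce = real_cond_exp_intg[OF int[of z] Z(1), simplified]
    have ae: "AE \<omega> in P x. Z \<omega> * real_cond_exp (P x) (past M X s) (?I z) \<omega> = Z \<omega> * transition P X h (X s \<omega>) z"
      using markov[OF s h, of x z] by eventually_elim simp
    show "(\<integral>\<omega>. Z \<omega> * ?I z \<omega> \<partial>P x) = (\<integral>\<omega>. Z \<omega> * transition P X h (X s \<omega>) z \<partial>P x)"
      unfolding ce(2)[symmetric] by (rule integral_cong_AE[OF _ _ ae]) simp_all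
    show "integrable (P x) (\<lambda>\<omega>. Z \<omega> * transition P X h (X s \<omega>) z)"
      by (rule integrable_cong_AE_imp[OF ce(1) _ ae]) simp
  qed
  have "(\<integral>\<omega>. Z \<omega> * g (X (s + h) \<omega>) \<partial>P x) = (\<integral>\<omega>. (\<Sum>z\<in>UNIV. g z * (Z \<omega> * ?I z \<omega>)) \<partial>P x)"
  proof (rule Bochner_Integration.integral_cong[OF refl])
    fix \<omega> assume "\<omega> \<in> space (P x)"
    then have "(\<Sum>z\<in>UNIV. g z * (Z \<omega> * ?I z \<omega>)) = (\<Sum>z\<in>UNIV. if X (s + h) \<omega> = z then g z * Z \<omega> else 0)"
      by (intro sum.cong) (auto simp: space_P)
    then show "Z \<omega> * g (X (s + h) \<omega>) = (\<Sum>z\<in>UNIV. g z * (Z \<omega> * ?I z \<omega>))" by simp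
  qed
  also have "\<dots> = (\<Sum>z\<in>UNIV. g z * (\<integral>\<omega>. Z \<omega> * ?I z \<omega> \<partial>P x))"
    using int by simp
  also have "\<dots> = (\<Sum>z\<in>UNIV. g z * (\<integral>\<omega>. Z \<omega> * transition P X h (X s \<omega>) z \<partial>P x))"
    unfolding eq ..
  also have "\<dots> = (\<integral>\<omega>. (\<Sum>z\<in>UNIV. g z * (Z \<omega> * transition P X h (X s \<omega>) z)) \<partial>P x)"
    using int' by simp
  finally show ?thesis by (simp add: sum_distrib_left algebra_simps)
qed

text \<open>
  The factors are peeled off from the latest time backwards: the last step turns \<open>w \<sqdot> g\<close> at time
  \<open>(n + 1) h\<close> into the kernel applied to \<open>g\<close> at time \<open>n h\<close>, while the earlier factors belong to the past.
  The function \<open>g\<close> is there to make this induction work.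
\<close>

lemma expectation_product:
  assumes h: "0 \<le> h"
  shows "(\<integral>\<omega>. (\<Prod>k<n. w (X (real (Suc k) * h) \<omega>)) * g (X (real n * h) \<omega>) \<partial>P x)
    = (generator (\<chi> x y. transition P X h x y * w y) ^^ n) g x"
proof (induction n arbitrary: g)
  case 0
  interpret prob_space "P x" by (rule prob)
  have "AE \<omega> in P x. \<omega> \<in> {\<omega> \<in> space M. X 0 \<omega> = x}"
    by (rule prob_eq_1[THEN iffD1, OF _ start])
       (use measurable_sets[OF measurable_X[of 0], of "{x}"] in \<open>auto simp: sets_P vimage_def Int_def conj_commute\<close>)
  then have "(\<integral>\<omega>. g (X 0 \<omega>) \<partial>P x) = (\<integral>\<omega>. g x \<partial>P x)"
    by (intro integral_cong_AE measurable_state) auto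
  then show ?case by (simp add: prob_space)
next
  case (Suc n)
  let ?K = "\<chi> x y. transition P X h x y * w y"
  let ?Z = "\<lambda>\<omega>. \<Prod>k<n. w (X (real (Suc k) * h) \<omega>)"
  have Z: "?Z \<in> borel_measurable (past M X (real n * h))"
  proof (intro borel_measurable_prod)
    fix k assume "k \<in> {..<n}"
    then have "real (Suc k) * h \<le> real n * h" using h by (intro mult_right_mono) auto
    then show "(\<lambda>\<omega>. w (X (real (Suc k) * h) \<omega>)) \<in> borel_measurable (past M X (real n * h))"
      using h by (intro measurable_compose[OF measurable_past]) auto
  qed
  have bound: "\<bar>?Z \<omega>\<bar> \<le> sup_norm w ^ n" for \<omega>
  proof -
    have "\<bar>?Z \<omega>\<bar> \<le> (\<Prod>k<n. sup_norm w)"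
      unfolding abs_prod by (intro prod_mono) (auto intro: abs_le_sup_norm)
    then show ?thesis by simp
  qed
  have "(\<integral>\<omega>. (\<Prod>k<Suc n. w (X (real (Suc k) * h) \<omega>)) * g (X (real (Suc n) * h) \<omega>) \<partial>P x)
      = (\<integral>\<omega>. ?Z \<omega> * (\<lambda>y. w y * g y) (X (real n * h + h) \<omega>) \<partial>P x)"
    by (simp add: algebra_simps)
  also have "\<dots> = (\<integral>\<omega>. ?Z \<omega> * (\<Sum>z\<in>UNIV. transition P X h (X (real n * h) \<omega>) z * (w z * g z)) \<partial>P x)"
    using h by (intro expectation_Markov_step[OF _ _ Z bound]) auto
  also have "\<dots> = (\<integral>\<omega>. ?Z \<omega> * generator ?K g (X (real n * h) \<omega>) \<partial>P x)"
    by (simp add: generator_def mult.assoc)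
  also have "\<dots> = (generator ?K ^^ n) (generator ?K g) x" by (rule Suc.IH)
  finally show ?case by (simp add: funpow_swap1)
qed

text \<open>
  With right end points as nodes, the step functions \<open>\<phi> n\<close> converge at every time of \<open>[0, t)\<close>: the
  node assigned to \<open>s\<close> lies strictly to the right of \<open>s\<close> and at distance at most \<open>t / n\<close>, and the
  path is constant on an interval to the right of \<open>s\<close>. So dominated convergence applies. As a limit of
  step functions the integrand is also measurable in time.
\<close>

lemma Riemann_sums_LIMSEQ:
  assumes \<omega>: "\<omega> \<in> space M" and t: "0 < t"
  shows "(\<lambda>n. \<Sum>k<n. t / real n * f (X (real (Suc k) * (t / real n)) \<omega>)) \<longlonglongrightarrow> additive_functional X f t \<omega>"
proof -
  define c where "c n k = f (X (real (Suc k) * (t / real n)) \<omega>)" for n k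
  define \<phi> where "\<phi> n s = (\<Sum>k<n. indicator {real k * (t / real n)..<real (Suc k) * (t / real n)} s * c n k)" for n s
  define \<psi> where "\<psi> s = indicator {0..<t} s * f (X s \<omega>)" for s
  define m where "m = sup_norm f"
  have m: "\<bar>f y\<bar> \<le> m" for y by (simp add: m_def abs_le_sup_norm)
  have phi: "\<phi> n s = indicator {0..<t} s * c n (nat \<lfloor>s / (t / real n)\<rfloor>)" if n: "0 < n" for n s
  proof -
    let ?h = "t / real n" and ?k = "nat \<lfloor>s / (t / real n)\<rfloor>"
    have hpos: "0 < ?h" using t n by simp
    have mem: "s \<in> {real k * ?h..<real (Suc k) * ?h} \<longleftrightarrow> 0 \<le> s \<and> k = ?k" for k
    proof -
      have "s \<in> {real k * ?h..<real (Suc k) * ?h} \<longleftrightarrow> real k \<le> s / ?h \<and> s / ?h < real k + 1"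
        unfolding atLeastLessThan_iff pos_le_divide_eq[OF hpos] pos_divide_less_eq[OF hpos]
            by (simp add: add.commute)
      also have "\<dots> \<longleftrightarrow> \<lfloor>s / ?h\<rfloor> = int k" by (simp add: floor_eq_iff)
      also have "\<dots> \<longleftrightarrow> 0 \<le> \<lfloor>s / ?h\<rfloor> \<and> k = ?k"
        using nat_eq_iff2[of k "\<lfloor>s / ?h\<rfloor>"] by linarith
      also have "0 \<le> \<lfloor>s / ?h\<rfloor> \<longleftrightarrow> 0 \<le> s"
        unfolding zero_le_floor using pos_le_divide_eq[OF hpos, of 0 s] by simp
      finally show ?thesis .
    qed
    have lt: "?k < n \<longleftrightarrow> s < t" if "0 \<le> s"
    proof -
      have "?k < n \<longleftrightarrow> \<lfloor>s / ?h\<rfloor> < int n" using n by linarith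
      also have "\<dots> \<longleftrightarrow> s / ?h < real n" by (simp add: floor_less_iff)
      also have "\<dots> \<longleftrightarrow> s < t" using hpos n t by (simp add: field_simps)
      finally show ?thesis .
    qed
    have "\<phi> n s = (\<Sum>k<n. if ?k = k then (if 0 \<le> s then c n k else 0) else 0)"
      unfolding \<phi>_def indicator_def mem by (intro sum.cong refl) simp
    then show ?thesis using lt by (auto simp: indicator_def)
  qed
  have bound: "\<bar>\<phi> n s\<bar> \<le> m * indicator {0..<t} s" for n s
  proof (cases "n = 0")
    case True
    have "0 \<le> m" using m[of undefined] by linarith
    then show ?thesis using True by (simp add: \<phi>_def)
  next
    case False
    then show ?thesis using m by (simp add: phi indicator_def c_def)
  qed
  have lim: "(\<lambda>n. \<phi> n s) \<longlonglongrightarrow> \<psi> s" for s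
  proof (cases "0 \<le> s \<and> s < t")
    case False
    have "\<forall>\<^sub>F n in sequentially. \<phi> n s = \<psi> s"
      using eventually_gt_at_top[of 0] by eventually_elim (use False in \<open>auto simp: phi \<psi>_def\<close>)
    then show ?thesis by (rule tendsto_eventually)
  next
    case True
    obtain b where b: "s < b" "\<And>y. s < y \<Longrightarrow> y < b \<Longrightarrow> X y \<omega> = X s \<omega>"
      using right_continuous[OF \<omega>, of s] True unfolding eventually_at_right_field by auto
    have "(\<lambda>n. t / real n) \<longlonglongrightarrow> 0" by real_asymp
    then have "\<forall>\<^sub>F n in sequentially. t / real n < b - s"
      by (rule order_tendstoD) (use b in simp)
    then have "\<forall>\<^sub>F n in sequentially. \<phi> n s = \<psi> s"
      using eventually_gt_at_top[of 0]
    proof eventually_elim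
      case (elim n)
      let ?h = "t / real n"
      let ?k = "nat \<lfloor>s / ?h\<rfloor>"
      have hpos: "0 < ?h" using t elim by simp
      have k: "real ?k \<le> s / ?h" "s / ?h < real ?k + 1" using True hpos by (simp_all add: of_nat_nat)
      have "s < real (Suc ?k) * ?h" using k(2) unfolding pos_divide_less_eq[OF hpos] by (simp add: add.commute)
      moreover have "real (Suc ?k) * ?h < b"
      proof -
        have "real (Suc ?k) * ?h = real ?k * ?h + ?h" by (simp only: of_nat_Suc distrib_right mult_1)
        also have "\<dots> < s + (b - s)"
          using k(1) elim(1) unfolding pos_le_divide_eq[OF hpos] by (rule add_le_less_mono)
        finally show ?thesis by simp
      qed
      ultimately have "X (real (Suc ?k) * ?h) \<omega> = X s \<omega>" by (rule b(2))
      then show ?case using elim(2) by (simp add: phi \<psi>_def c_def)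
    qed
    then show ?thesis by (rule tendsto_eventually)
  qed
  have integrable_Ico: "integrable lborel (indicator {a..<b} :: real \<Rightarrow> real)" for a b :: real
    by (intro integrable_real_indicator emeasure_bounded_finite bounded_subset[OF bounded_closed_interval[of a b]]) auto
  have phi_int: "(\<integral>s. \<phi> n s \<partial>lborel) = (\<Sum>k<n. t / real n * c n k)" for n
  proof -
    have "(\<integral>s. \<phi> n s \<partial>lborel) = (\<Sum>k<n. \<integral>s. indicator {real k * (t / real n)..<real (Suc k) * (t / real n)} s * c n k \<partial>lborel)"
      unfolding \<phi>_def by (intro Bochner_Integration.integral_sum integrable_mult_left integrable_Ico)
    also have "\<dots> = (\<Sum>k<n. t / real n * c n k)"
    proof (intro sum.cong refl)
      fix k
      have le: "real k * (t / real n) \<le> real (Suc k) * (t / real n)" using t by (intro mult_right_mono) auto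
      have "(\<integral>s. indicator {real k * (t / real n)..<real (Suc k) * (t / real n)} s * c n k \<partial>lborel)
        = measure lborel {real k * (t / real n)..<real (Suc k) * (t / real n)} * c n k" by simp
      also have "measure lborel {real k * (t / real n)..<real (Suc k) * (t / real n)}
          = real (Suc k) * (t / real n) - real k * (t / real n)"
        using le by (rule measure_lborel_Ico)
      also have "\<dots> = t / real n" by (simp only: of_nat_Suc distrib_right)
      finally show "(\<integral>s. indicator {real k * (t / real n)..<real (Suc k) * (t / real n)} s * c n k \<partial>lborel)
          = t / real n * c n k" .
    qed
    finally show ?thesis .
  qed
  have meas: "\<phi> n \<in> borel_measurable lborel" for n unfolding \<phi>_def by measurable
  have "(\<lambda>n. \<integral>s. \<phi> n s \<partial>lborel) \<longlonglongrightarrow> (\<integral>s. \<psi> s \<partial>lborel)"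
  proof (rule integral_dominated_convergence[where w = "\<lambda>s. m * indicator {0..<t} s"])
    show "\<psi> \<in> borel_measurable lborel" by (rule borel_measurable_LIMSEQ_real[OF lim meas])
    show "integrable lborel (\<lambda>s. m * indicator {0..<t} s)"
      by (intro integrable_mult_right integrable_Ico)
  qed (use lim meas bound in auto)
  moreover have "(\<integral>s. \<psi> s \<partial>lborel) = additive_functional X f t \<omega>"
    unfolding additive_functional_def set_lebesgue_integral_def \<psi>_def
    by (rule integral_discrete_difference[of "{t}"]) (auto simp: indicator_def)
  ultimately show ?thesis unfolding phi_int c_def by simp
qed

definition Riemann_sum :: "('e \<Rightarrow> real) \<Rightarrow> real \<Rightarrow> nat \<Rightarrow> 'w \<Rightarrow> real" where
  "Riemann_sum f t n \<omega> = (\<Sum>k<n. t / real n * f (X (real (Suc k) * (t / real n)) \<omega>))"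

lemma Riemann_sum_measurable:
  assumes "0 < t" shows "Riemann_sum f t n \<in> borel_measurable (P x)"
  unfolding Riemann_sum_def using assms
  by (intro borel_measurable_sum borel_measurable_times measurable_state) auto

lemma abs_Riemann_sum_le:
  assumes "0 < t" "\<And>y. \<bar>f y\<bar> \<le> m"
  shows "\<bar>Riemann_sum f t n \<omega>\<bar> \<le> t * m"
proof (cases "n = 0")
  case True
  have "0 \<le> m" using order_trans[OF abs_ge_zero assms(2)] .
  then show ?thesis using True assms(1) by (simp add: Riemann_sum_def)
next
  case False
  have "\<bar>Riemann_sum f t n \<omega>\<bar> \<le> (\<Sum>k<n. t / real n * m)"
    unfolding Riemann_sum_def
  proof (intro order_trans[OF sum_abs] sum_mono)
    fix k
    have "\<bar>t / real n * f y\<bar> = t / real n * \<bar>f y\<bar>" for y using assms(1) by (simp add: abs_mult)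
    then show "\<bar>t / real n * f (X (real (Suc k) * (t / real n)) \<omega>)\<bar> \<le> t / real n * m"
      using assms by (simp only: ) (intro mult_left_mono, auto)
  qed
  also have "\<dots> = t * m" using False by simp
  finally show ?thesis .
qed

lemma additive_functional_measurable:
  assumes "0 < t" shows "additive_functional X f t \<in> borel_measurable (P x)"
proof (rule borel_measurable_LIMSEQ_real)
  show "(\<lambda>n. Riemann_sum f t n \<omega>) \<longlonglongrightarrow> additive_functional X f t \<omega>" if "\<omega> \<in> space (P x)" for \<omega>
    unfolding Riemann_sum_def using that assms by (intro Riemann_sums_LIMSEQ) (auto simp: space_P)
qed (rule Riemann_sum_measurable[OF assms])

lemma exponential_moment_LIMSEQ:
  fixes r :: real
  assumes t: "0 < t"
  shows "(\<lambda>n. \<integral>\<omega>. exp (r * Riemann_sum f t n \<omega>) \<partial>P x) \<longlonglongrightarrow> (\<integral>\<omega>. exp (r * additive_functional X f t \<omega>) \<partial>P x)"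
    and "integrable (P x) (\<lambda>\<omega>. exp (r * additive_functional X f t \<omega>))"
proof -
  interpret prob_space "P x" by (rule prob)
  define m where "m = sup_norm f"
  have m: "\<bar>f y\<bar> \<le> m" for y by (simp add: m_def abs_le_sup_norm)
  note [measurable] = Riemann_sum_measurable[OF t, of f] additive_functional_measurable[OF t, of f]
  have lim: "(\<lambda>n. exp (r * Riemann_sum f t n \<omega>)) \<longlonglongrightarrow> exp (r * additive_functional X f t \<omega>)" if "\<omega> \<in> space (P x)" for \<omega>
    unfolding Riemann_sum_def using that t by (intro tendsto_intros Riemann_sums_LIMSEQ) (auto simp: space_P)
  have bound: "norm (exp (r * Riemann_sum f t n \<omega>)) \<le> exp (\<bar>r\<bar> * (t * m))" for n \<omega>
  proof -
    have "r * Riemann_sum f t n \<omega> \<le> \<bar>r\<bar> * \<bar>Riemann_sum f t n \<omega>\<bar>" by (metis abs_ge_self abs_mult)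
    also have "\<dots> \<le> \<bar>r\<bar> * (t * m)" by (intro mult_left_mono abs_Riemann_sum_le t m) auto
    finally show ?thesis by simp
  qed
  show "(\<lambda>n. \<integral>\<omega>. exp (r * Riemann_sum f t n \<omega>) \<partial>P x) \<longlonglongrightarrow> (\<integral>\<omega>. exp (r * additive_functional X f t \<omega>) \<partial>P x)"
    by (rule integral_dominated_convergence[where w = "\<lambda>_. exp (\<bar>r\<bar> * (t * m))"]) (use lim bound in auto)
  show "integrable (P x) (\<lambda>\<omega>. exp (r * additive_functional X f t \<omega>))"
    by (rule integrable_dominated_convergence[where w = "\<lambda>_. exp (\<bar>r\<bar> * (t * m))"
        and s = "\<lambda>n \<omega>. exp (r * Riemann_sum f t n \<omega>)"])
       (use lim bound in auto)
qed

text \<open>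
  A discrete Feynman-Kac formula: the exponential of the Riemann sum is a product of weights, one for each
  node, and each step contributes one application of the transition matrix followed by its weight.
\<close>

lemma exponential_moment_Riemann_sum:
  assumes t: "0 < t"
  shows "(\<integral>\<omega>. exp (r * Riemann_sum f t n \<omega>) \<partial>P x)
    = (generator (\<chi> x y. transition P X (t / real n) x y * exp (t / real n * (r * f y))) ^^ n) (\<lambda>_. 1) x"
proof -
  have "exp (r * Riemann_sum f t n \<omega>)
      = (\<Prod>k<n. exp (t / real n * (r * f (X (real (Suc k) * (t / real n)) \<omega>)))) * 1" for \<omega>
    unfolding Riemann_sum_def by (simp add: sum_distrib_left algebra_simps flip: exp_sum)
  then show ?thesis using expectation_product[where h = "t / real n"
      and w = "\<lambda>y. exp (t / real n * (r * f y))" and n = n and g = "\<lambda>_. 1" and x = x] t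
    by simp
qed

lemma Chernoff_bound:
  assumes t: "0 < t" and r: "0 \<le> r"
  shows "measure (P x) {\<omega> \<in> space M. additive_functional X f t \<omega> / t \<ge> u}
    \<le> exp (- (r * t * u)) * (\<integral>\<omega>. exp (r * additive_functional X f t \<omega>) \<partial>P x)"
proof -
  interpret prob_space "P x" by (rule prob)
  let ?A = "additive_functional X f t"
  let ?S = "{\<omega> \<in> space M. ?A \<omega> / t \<ge> u}"
  note [measurable] = additive_functional_measurable[OF t, of f]
  have S: "?S \<in> sets (P x)" unfolding space_P[of x, symmetric] by measurable
  have "measure (P x) ?S = (\<integral>\<omega>. indicator ?S \<omega> \<partial>P x)" using S by simp
  also have "\<dots> \<le> (\<integral>\<omega>. exp (- (r * t * u)) * exp (r * ?A \<omega>) \<partial>P x)"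
  proof (rule integral_mono)
    show "integrable (P x) (indicator ?S :: 'w \<Rightarrow> real)" using S by (simp add: emeasure_eq_measure)
    show "integrable (P x) (\<lambda>\<omega>. exp (- (r * t * u)) * exp (r * ?A \<omega>))"
      using exponential_moment_LIMSEQ(2)[OF t] by simp
    fix \<omega>
    show "indicator ?S \<omega> \<le> exp (- (r * t * u)) * exp (r * ?A \<omega>)"
    proof (cases "\<omega> \<in> ?S")
      case True
      then have "t * u \<le> ?A \<omega>" using t by (simp add: pos_le_divide_eq mult.commute)
      then have "r * (t * u) \<le> r * ?A \<omega>" using r by (rule mult_left_mono)
      then show ?thesis using True by (simp flip: exp_add)
    qed simp
  qed
  finally show ?thesis by simp
qed

end

section \<open>The deviation inequality\<close>

text \<open>
  One step of the discrete Feynman-Kac evolution. To first order in \<open>h\<close> it agrees with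
  \<open>exp (h (Q + w))\<close>, the function \<open>w\<close> acting by multiplication.
\<close>

definition tilted_kernel :: "real ^ 'e ^ 'e \<Rightarrow> ('e \<Rightarrow> real) \<Rightarrow> real \<Rightarrow> real ^ 'e::finite ^ 'e" where
  "tilted_kernel Q w h = (\<chi> x y. mat_exp (h *\<^sub>R Q) $ x $ y * exp (h * w y))"

lemma tilted_kernel_0: "tilted_kernel Q w 0 = mat 1"
  using mat_exp_0[of Q] by (simp add: tilted_kernel_def mat_def vec_eq_iff)

lemma tilted_kernel_deriv:
  "((\<lambda>h. tilted_kernel Q w h $ x $ y) has_field_derivative (Q + (\<chi> x y. if x = y then w x else 0)) $ x $ y) (at 0)"
proof -
  have "((\<lambda>h. exp (h * w y)) has_field_derivative w y) (at 0)"
    by (auto intro!: derivative_eq_intros)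
  from DERIV_mult[OF mat_exp_entry_deriv_0[of Q x y] this]
  show ?thesis using mat_exp_0[of Q x y] by (auto simp: tilted_kernel_def)
qed

lemma generator_plus_diagonal:
  "generator (Q + (\<chi> x y. if x = y then w x else 0)) g = (\<lambda>x. generator Q g x + w x * g x)"
proof
  fix x
  have "(\<Sum>y\<in>UNIV. (if x = y then w x else 0) * g y) = (\<Sum>y\<in>UNIV. if x = y then w x * g y else 0)"
    by (intro sum.cong) auto
  then show "generator (Q + (\<chi> x y. if x = y then w x else 0)) g x = generator Q g x + w x * g x"
    by (simp add: generator_def distrib_right sum.distrib)
qed

text \<open>
  The Legendre transform of \<open>r\<^sup>2 V / (l - r m)\<close> at \<open>u\<close>. With \<open>s\<close> the square root in the result, the maximiser
  satisfies \<open>1 - r m / l = 1 / s\<close>; writing it with \<open>s + 1\<close> in the denominator rather than as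
  \<open>(l / m) (1 - 1 / s)\<close> covers \<open>m = 0\<close> and \<open>u = 0\<close>.
\<close>

lemma Bernstein_optimal_tilt:
  fixes V l m u :: real
  assumes V: "0 < V" and l: "0 < l" and m: "0 \<le> m" and u: "0 \<le> u"
  defines "v \<equiv> 2 * V / l"
  obtains r where "0 \<le> r" "r * m < l"
    "r\<^sup>2 * V / (l - r * m) - r * u = - (2 * u\<^sup>2 / (v * (1 + sqrt (1 + 2 * m * u / (l * v)))\<^sup>2))"
proof -
  define s where "s = sqrt (1 + 2 * m * u / (l * v))"
  define r where "r = 2 * u / (v * s * (s + 1))"
  have v: "0 < v" using V l by (simp add: v_def)
  have q: "0 \<le> 2 * m * u / (l * v)" using v l m u by simp
  have s: "1 \<le> s" using q by (simp add: s_def)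
  have s2: "s * s = 1 + 2 * m * u / (l * v)" using q by (simp add: s_def)
  have rm: "r * m = l * (1 - 1 / s)"
  proof -
    have "2 * m * u = (s - 1) * (s + 1) * (l * v)"
      using s2 v l by (simp add: algebra_simps)
    then have "r * m = (s - 1) * (s + 1) * (l * v) / (v * s * (s + 1))"
      by (simp add: r_def algebra_simps)
    also have "\<dots> = l * (s - 1) / s" using s v by simp
    also have "\<dots> = l * (1 - 1 / s)" using s by (simp add: field_simps)
    finally show ?thesis .
  qed
  have "r\<^sup>2 * V / (l - r * m) = r\<^sup>2 * (v * s) / 2"
  proof -
    have "l - r * m = l / s" unfolding rm using s by (simp add: field_simps)
    then show ?thesis using s l by (simp add: v_def)
  qed
  also have "\<dots> = 2 * u\<^sup>2 / (v * s * (s + 1)\<^sup>2)"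
    using s v by (simp add: r_def power2_eq_square divide_simps)
  finally have "r\<^sup>2 * V / (l - r * m) - r * u
      = 2 * u\<^sup>2 / (v * s * (s + 1)\<^sup>2) - 2 * u\<^sup>2 * (s + 1) / (v * s * (s + 1)\<^sup>2)"
    using s v by (simp add: r_def power2_eq_square)
  also have "\<dots> = - (2 * u\<^sup>2 * s) / (v * s * (s + 1)\<^sup>2)"
    by (simp add: algebra_simps flip: diff_divide_distrib)
  also have "\<dots> = - (2 * u\<^sup>2 / (v * (1 + s)\<^sup>2))" using s by (simp add: add.commute)
  finally have "r\<^sup>2 * V / (l - r * m) - r * u = - (2 * u\<^sup>2 / (v * (1 + s)\<^sup>2))" .
  moreover have "0 \<le> r" using u v s by (simp add: r_def)
  moreover have "r * m < l" unfolding rm using l s by (simp add: algebra_simps)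
  ultimately show ?thesis by (intro that[of r]) (simp_all add: s_def)
qed

text \<open>
  For each \<open>n\<close> the exponential moment of the Riemann sum is the inner product of \<open>d\<nu>/d\<pi>\<close> with the \<open>n\<close>-fold
  kernel applied to \<open>1\<close>, so Cauchy-Schwarz separates the initial law from the growth of the kernel.
  The error \<open>e\<close> in the growth rate is removed only after the limit in \<open>n\<close>.
\<close>

lemma exponential_moment_bound:
  fixes P :: "'e::finite \<Rightarrow> 'w measure" and f :: "'e \<Rightarrow> real"
  assumes "markov_jump_process M P X" and Q: "rate_matrix P X Q" and "ergodic_rates \<pi> Q"
    and f: "l2_inner \<pi> f (\<lambda>_. 1) = 0" "f \<noteq> (\<lambda>_. 0)" "\<And>x. \<bar>f x\<bar> \<le> m"
    and r: "0 \<le> r" "r * m < spectral_gap \<pi> Q" and t: "0 < t"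
  shows "(\<Sum>x\<in>UNIV. pmf \<nu> x * (\<integral>\<omega>. exp (r * additive_functional X f t \<omega>) \<partial>P x))
    \<le> l2_norm \<pi> (\<lambda>x. pmf \<nu> x / pmf \<pi> x) * exp (t * (r\<^sup>2 * l2_inner \<pi> f f / (spectral_gap \<pi> Q - r * m)))"
proof -
  interpret markov_jump_process M P X by fact
  interpret ergodic_rates \<pi> Q by fact
  define c where "c = r\<^sup>2 * l2_inner \<pi> f f / (spectral_gap \<pi> Q - r * m)"
  define K where "K = tilted_kernel Q (\<lambda>x. r * f x)"
  let ?N = "l2_norm \<pi> (\<lambda>x. pmf \<nu> x / pmf \<pi> x)"
  let ?E = "\<Sum>x\<in>UNIV. pmf \<nu> x * (\<integral>\<omega>. exp (r * additive_functional X f t \<omega>) \<partial>P x)"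
  let ?En = "\<lambda>n. \<Sum>x\<in>UNIV. pmf \<nu> x * (\<integral>\<omega>. exp (r * Riemann_sum f t n \<omega>) \<partial>P x)"
  have lim: "?En \<longlonglongrightarrow> ?E"
    by (intro tendsto_sum tendsto_mult tendsto_const exponential_moment_LIMSEQ t)
  have En: "?En n = l2_inner \<pi> (\<lambda>x. pmf \<nu> x / pmf \<pi> x) ((generator (K (t / real n)) ^^ n) (\<lambda>_. 1))" for n
  proof -
    have "(\<chi> x y. transition P X (t / real n) x y * exp (t / real n * (r * f y))) = K (t / real n)"
      using Q t unfolding K_def tilted_kernel_def rate_matrix_def by (simp add: vec_eq_iff)
    then show ?thesis
      unfolding l2_inner_def exponential_moment_Riemann_sum[OF t]
      using pi_pos by (intro sum.cong refl) (simp add: less_le)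
  qed
  have bound: "?E \<le> ?N * exp (t * (c + e))" if e: "0 < e" for e
  proof (rule tendsto_upperbound[OF lim])
    have form: "l2_inner \<pi> g (generator (Q + (\<chi> x y. if x = y then r * f x else 0)) g) \<le> c * l2_inner \<pi> g g" for g
      using perturbed_form_bound[OF f r, of g] unfolding generator_plus_diagonal c_def by (simp add: mult.assoc)
    have "\<forall>\<^sub>F n in sequentially. \<forall>g. l2_norm \<pi> ((generator (K (t / real n)) ^^ n) g)
        \<le> exp (t * (c + e)) * l2_norm \<pi> g"
      unfolding K_def
      by (rule n_step_growth[OF pi_pos tilted_kernel_0 tilted_kernel_deriv form e t])
    then show "\<forall>\<^sub>F n in sequentially. ?En n \<le> ?N * exp (t * (c + e))"
    proof eventually_elim
      case (elim n)
      let ?g = "(generator (K (t / real n)) ^^ n) (\<lambda>_. 1)"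
      have "?En n \<le> ?N * l2_norm \<pi> ?g" unfolding En by (rule order_trans[OF abs_ge_self l2_Cauchy_Schwarz])
      also have "\<dots> \<le> ?N * (exp (t * (c + e)) * l2_norm \<pi> (\<lambda>_. 1))"
        by (intro mult_left_mono elim[rule_format] l2_norm_nonneg)
      also have "\<dots> = ?N * exp (t * (c + e))" by (simp add: l2_norm_def l2_inner_one)
      finally show ?case .
    qed
  qed simp
  have "((\<lambda>e. ?N * exp (t * (c + e))) \<longlongrightarrow> ?N * exp (t * (c + 0))) (at_right 0)"
    by (intro tendsto_intros)
  then have "?E \<le> ?N * exp (t * (c + 0))"
    by (rule tendsto_lowerbound) (use bound in \<open>auto simp: eventually_at_right_field intro: exI[of _ 1]\<close>)
  then show ?thesis by (simp add: c_def)
qed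

theorem theorem3p3p32:
  fixes M :: "'w measure"
    and P :: "'e::finite \<Rightarrow> 'w measure"
    and X :: "real \<Rightarrow> 'w \<Rightarrow> 'e"
    and Q :: "real ^ 'e ^ 'e"
    and \<pi> \<nu> :: "'e pmf"
    and f :: "'e \<Rightarrow> real"
    and t u :: real
  assumes "2 \<le> CARD('e)"
    and "markov_jump_process M P X"
    and "rate_matrix P X Q"
    and "irreducible_mjp P X"
    and "invariant_distribution Q \<pi>"
    and "\<not> f constant_on UNIV"
    and "measure_pmf.expectation \<pi> f = 0"
    and "0 < t"
    and "0 \<le> u"
  shows "initial_prob P \<nu> {\<omega> \<in> space M. additive_functional X f t \<omega> / t \<ge> u}
    \<le> l2_norm \<pi> (\<lambda>x. pmf \<nu> x / pmf \<pi> x)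
      * exp (- (2 * t * u\<^sup>2 /
          (variance_proxy \<pi> Q f *
            (1 + sqrt (1 + 2 * sup_norm f * u / (spectral_gap \<pi> Q * variance_proxy \<pi> Q f)))\<^sup>2)))"
proof -
  interpret markov_jump_process M P X by fact
  have rates: "ergodic_rates \<pi> Q"
  proof
    fix s :: real and x y :: 'e
    assume s: "0 < s"
    then have "mat_exp (s *\<^sub>R Q) $ x $ y = transition P X s x y"
      using assms(3) by (simp add: rate_matrix_def)
    then show "0 < mat_exp (s *\<^sub>R Q) $ x $ y"
      using assms(4) s by (simp add: irreducible_mjp_def)
  qed (use assms(3,5) in \<open>auto simp: rate_matrix_def\<close>)
  interpret ergodic_rates \<pi> Q by (rule rates)
  let ?V = "l2_inner \<pi> f f" and ?l = "spectral_gap \<pi> Q" and ?m = "sup_norm f"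
  have mean: "l2_inner \<pi> f (\<lambda>_. 1) = 0"
    using assms(7) by (subst (asm) integral_measure_pmf_real[of UNIV]) (auto simp: l2_inner_def)
  have nonzero: "f \<noteq> (\<lambda>_. 0)" using assms(6) by (auto simp: constant_on_def)
  have var: "measure_pmf.variance \<pi> f = ?V"
    unfolding assms(7) by (subst integral_measure_pmf_real[of UNIV]) (auto simp: l2_inner_def power2_eq_square)
  have V: "0 < ?V"
    using l2_inner_self_eq_0[OF pi_pos, of f] nonzero l2_inner_self_nonneg[of \<pi> f]
        by (force simp: fun_eq_iff less_le)
  have m: "\<bar>f x\<bar> \<le> ?m" for x by (rule abs_le_sup_norm)
  have l: "0 < ?l" by (rule spectral_gap_pos[OF mean nonzero])
  obtain r where r: "0 \<le> r" "r * ?m < ?l"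
    "r\<^sup>2 * ?V / (?l - r * ?m) - r * u
      = - (2 * u\<^sup>2 / (2 * ?V / ?l * (1 + sqrt (1 + 2 * ?m * u / (?l * (2 * ?V / ?l))))\<^sup>2))"
    by (rule Bernstein_optimal_tilt[OF V l order_trans[OF abs_ge_zero m] assms(9)])
  let ?A = "additive_functional X f t"
  have "initial_prob P \<nu> {\<omega> \<in> space M. ?A \<omega> / t \<ge> u}
      \<le> (\<Sum>x\<in>UNIV. pmf \<nu> x * (exp (- (r * t * u)) * (\<integral>\<omega>. exp (r * ?A \<omega>) \<partial>P x)))"
    unfolding initial_prob_def by (intro sum_mono mult_left_mono Chernoff_bound assms(8) r(1)) simp
  also have "\<dots> = exp (- (r * t * u)) * (\<Sum>x\<in>UNIV. pmf \<nu> x * (\<integral>\<omega>. exp (r * ?A \<omega>) \<partial>P x))"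
    by (simp add: sum_distrib_left algebra_simps)
  also have "\<dots> \<le> exp (- (r * t * u)) *
      (l2_norm \<pi> (\<lambda>x. pmf \<nu> x / pmf \<pi> x) * exp (t * (r\<^sup>2 * ?V / (?l - r * ?m))))"
    by (intro mult_left_mono exponential_moment_bound[OF assms(2,3) rates mean nonzero m r(1,2) assms(8)]) simp
  also have "\<dots> = l2_norm \<pi> (\<lambda>x. pmf \<nu> x / pmf \<pi> x) * exp (t * (r\<^sup>2 * ?V / (?l - r * ?m) - r * u))"
    by (simp add: algebra_simps exp_diff exp_minus field_simps)
  finally show ?thesis unfolding r(3) variance_proxy_def var by (simp add: algebra_simps)
qed

end
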